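(* The pseudovariety $\mathsf{Com}$ of all finite commutative monoids (in the signature of monoids) is strong.
   Context: For a pseudovariety $\mathsf U$ and finite set $A$, $\Omega_A\mathsf U$ is the free pro-$\mathsf U$ algebra on $A$ (here the free profinite commutative monoid). A $\mathsf U$-pseudoidentity is $u=v$ with $u,v\in\Omega_B\mathsf U$, $B$ finite; it holds in $T\in\mathsf U$ if both sides agree under every continuous homomorphism $\Omega_B\mathsf U\to T$; $[\![\Sigma]\!]_{\mathsf U}$ is the class of members of $\mathsf U$ satisfying $\Sigma$. Provability: for a set $\Sigma$ of $\mathsf U$-pseudoidentities and finite $A$, $\Sigma_0\subseteq\Omega_A\mathsf U\times\Omega_A\mathsf U$ is the set of pairs $(\mathbf t(\varphi(u),w_1,\dots,w_n),\mathbf t(\varphi(v),w_1,\dots,w_n))$ with $u=v$ or $v=u$ in $\Sigma$ ($u,v\in\Omega_B\mathsf U$), $\varphi:\Omega_B\mathsf U\to\Omega_A\mathsf U$ a continuous homomorphism, $\mathbf t$ a monoid term, $w_i\in\Omega_A\mathsf U$; $\Sigma_{2\alpha+1}$ is the transitive closure of $\Sigma_{2\alpha}$, $\Sigma_{2\alpha+2}$ the topological closure of $\Sigma_{2\alpha+1}$, unions at limit ordinals; $u=v$ is provable from $\Sigma$ if $(u,v)\in\bigcup_\alpha\Sigma_\alpha$. $\mathsf U$ is strong if for every set $\Sigma$ of $\mathsf U$-pseudoidentities, every $\mathsf U$-pseudoidentity valid in $[\![\Sigma]\!]_{\mathsf U}$ is provable from $\Sigma$.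
   Formalization: Trivial pairs (w,w) are added to Σ_0; this matters only for empty Σ, where the literal definition makes nothing provable although u=u is valid. The union of the Σ_α is stated as the least transitive, topologically closed relation containing Σ_0. *)

theory Defs
  imports "HOL-Analysis.Analysis" "HOL-Algebra.Group"
begin

(* Elements of the free commutative monoid on the generators {0..<n}:
   exponent vectors with support in {..<n}. *)
type_synonym fcm = "nat \<Rightarrow> nat"

definition FCM :: "nat \<Rightarrow> fcm set" where
  "FCM n = {a. \<forall>i\<ge>n. a i = 0}"

definition fcm_add :: "fcm \<Rightarrow> fcm \<Rightarrow> fcm" where
  "fcm_add a b = (\<lambda>i. a i + b i)"

definition fcm_zero :: fcm where
  "fcm_zero = (\<lambda>i. 0)"

(* congruences of finite index on the free commutative monoid on n generators;
   the quotients are exactly the finite commutative monoids generated by n elements *)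
definition Cong :: "nat \<Rightarrow> (fcm \<times> fcm) set set" where
  "Cong n = {\<theta>. equiv (FCM n) \<theta> \<and>
     (\<forall>a b c d. (a, b) \<in> \<theta> \<longrightarrow> (c, d) \<in> \<theta> \<longrightarrow> (fcm_add a c, fcm_add b d) \<in> \<theta>) \<and>
     finite (FCM n // \<theta>)}"

section \<open>The free profinite commutative monoid \<Omega>_n Com (inverse limit of finite quotients)\<close>

type_synonym om = "(fcm \<times> fcm) set \<Rightarrow> fcm set"

definition Omega :: "nat \<Rightarrow> om set" where
  "Omega n = {x. x \<in> (\<Pi>\<^sub>E \<theta>\<in>Cong n. FCM n // \<theta>) \<and>
     (\<forall>\<theta>\<in>Cong n. \<forall>\<theta>'\<in>Cong n. \<theta> \<subseteq> \<theta>' \<longrightarrow> x \<theta> \<subseteq> x \<theta>')}"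

definition om_mult :: "nat \<Rightarrow> om \<Rightarrow> om \<Rightarrow> om" where
  "om_mult n x y = (\<lambda>\<theta>\<in>Cong n. \<theta> `` {fcm_add (SOME a. a \<in> x \<theta>) (SOME b. b \<in> y \<theta>)})"

definition om_one :: "nat \<Rightarrow> om" where
  "om_one n = (\<lambda>\<theta>\<in>Cong n. \<theta> `` {fcm_zero})"

definition OmM :: "nat \<Rightarrow> om monoid" where
  "OmM n = \<lparr>carrier = Omega n, mult = om_mult n, one = om_one n\<rparr>"

definition OmT :: "nat \<Rightarrow> om topology" where
  "OmT n = subtopology (product_topology (\<lambda>\<theta>. discrete_topology (FCM n // \<theta>)) (Cong n)) (Omega n)"

definition monoid_hom :: "('a, 'c) monoid_scheme \<Rightarrow> ('b, 'd) monoid_scheme \<Rightarrow> ('a \<Rightarrow> 'b) set" where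
  "monoid_hom G H = {h. h \<in> hom G H \<and> h \<one>\<^bsub>G\<^esub> = \<one>\<^bsub>H\<^esub>}"

definition cont_hom :: "nat \<Rightarrow> nat \<Rightarrow> (om \<Rightarrow> om) set" where
  "cont_hom m n = {\<phi>. \<phi> \<in> monoid_hom (OmM m) (OmM n) \<and> continuous_map (OmT m) (OmT n) \<phi>}"

datatype mterm = MVar nat | MOne | MMul mterm mterm

fun meval :: "('a, 'c) monoid_scheme \<Rightarrow> (nat \<Rightarrow> 'a) \<Rightarrow> mterm \<Rightarrow> 'a" where
  "meval M \<rho> (MVar i) = \<rho> i"
| "meval M \<rho> MOne = \<one>\<^bsub>M\<^esub>"
| "meval M \<rho> (MMul s t) = meval M \<rho> s \<otimes>\<^bsub>M\<^esub> meval M \<rho> t"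

(* a pseudoidentity (n, u, v) stands for u = v with u, v \<in> \<Omega>_{n} Com *)
type_synonym pseudoid = "nat \<times> om \<times> om"

definition wf_pid :: "pseudoid \<Rightarrow> bool" where
  "wf_pid p = (case p of (n, u, v) \<Rightarrow> u \<in> Omega n \<and> v \<in> Omega n)"

(* finite commutative monoids (up to isomorphism, every one has a copy on a subset of nat) *)
definition Com :: "nat monoid set" where
  "Com = {T. comm_monoid T \<and> finite (carrier T)}"

definition holds_in :: "nat monoid \<Rightarrow> pseudoid \<Rightarrow> bool" where
  "holds_in T p = (case p of (n, u, v) \<Rightarrow>
     (\<forall>\<psi>. \<psi> \<in> monoid_hom (OmM n) T \<and>
          continuous_map (OmT n) (discrete_topology (carrier T)) \<psi> \<longrightarrow> \<psi> u = \<psi> v))"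

definition models :: "pseudoid set \<Rightarrow> nat monoid set" where
  "models \<Sigma> = {T \<in> Com. \<forall>p\<in>\<Sigma>. holds_in T p}"

definition Sigma0 :: "pseudoid set \<Rightarrow> nat \<Rightarrow> (om \<times> om) set" where
  "Sigma0 \<Sigma> n = {(w, w) | w. w \<in> Omega n} \<union>
     {(meval (OmM n) (\<rho>(0 := \<phi> u)) t, meval (OmM n) (\<rho>(0 := \<phi> v)) t) | m u v \<phi> \<rho> t.
        ((m, u, v) \<in> \<Sigma> \<or> (m, v, u) \<in> \<Sigma>) \<and> \<phi> \<in> cont_hom m n \<and> (\<forall>i. \<rho> i \<in> Omega n)}"

(* \<Union>_\<alpha> \<Sigma>_\<alpha>: the least relation containing \<Sigma>_0 that is transitive and
   topologically closed in \<Omega>_n \<times> \<Omega>_n (the transfinite iteration stabilises at it) *)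
definition provable_rel :: "pseudoid set \<Rightarrow> nat \<Rightarrow> (om \<times> om) set" where
  "provable_rel \<Sigma> n = \<Inter>{R. Sigma0 \<Sigma> n \<subseteq> R \<and> trans R \<and>
      (prod_topology (OmT n) (OmT n)) closure_of R \<subseteq> R}"

definition provable :: "pseudoid set \<Rightarrow> pseudoid \<Rightarrow> bool" where
  "provable \<Sigma> p = (case p of (n, u, v) \<Rightarrow> (u, v) \<in> provable_rel \<Sigma> n)"

definition strong_Com :: bool where
  "strong_Com = (\<forall>\<Sigma>. (\<forall>p\<in>\<Sigma>. wf_pid p) \<longrightarrow>
     (\<forall>p. wf_pid p \<and> (\<forall>T\<in>models \<Sigma>. holds_in T p) \<longrightarrow> provable \<Sigma> p))"

end

(* Given a set of pseudoidentities, the provable pairs form a closed congruence R on the free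
   profinite commutative monoid Omega n. If (u, v) is not in R, it suffices to find a congruence of
   finite index that contains R and separates u from v: its quotient T is a finite commutative
   monoid, and T satisfies the given pseudoidentities because every continuous homomorphism
   Omega m -> T lifts along Omega n -> T.

   Such a congruence exists because the quotient of Omega n by R is zero-dimensional. As Omega n is
   (N + Z^)^n, it is a countable union of closed pieces on which each coordinate either has a fixed
   finite degree or has infinite degree. Any two elements of one piece divide each other, so each
   piece is a coset of a profinite group, where closed subgroups are separated by open ones. The
   countable sum argument of dimension theory then yields a clopen R-saturated set containing u but
   not v, and its syntactic congruence is the desired one. *)

theory Submission
  imports Defs
begin

section \<open>Saturated sets of closed equivalence relations\<close>

text \<open>Closedness of \<open>R\<close> alone does not suffice: a closed equivalence relation on
  a profinite space can have a connected quotient, as when the Cantor set is mapped onto an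
  interval. What excludes this here is divisibility within a piece; no profinite group is formed.
  The pieces are in general neither open nor saturated, since \<open>R\<close> may relate points of
  different degrees, so separations found on single pieces cannot simply be glued. For this reason
  the statement about one piece starts from an arbitrary pair of disjoint saturated closed sets, and
  the sum argument absorbs the pieces in turn, thickening the pair after each of them. Divisibility
  itself comes from the finite levels: a congruence of finite index sees an exponent exactly only
  below a threshold, and above it modulo a period, so elements with the same truncated exponents
  divide each other at that level. Compactness carries this over to \<open>Omega n\<close>.\<close>

lemma closedin_Image:
  assumes "compact_space X" "closedin (prod_topology X Y) R" "closedin X F"
  shows "closedin Y (R `` F)"
proof -
  \<comment> \<open>The image of \<open>F\<close> under \<open>R\<close> is a projection along the
    compact factor \<open>X\<close>, and such a projection is a closed map.\<close>
  have "closedin (prod_topology X Y) (R \<inter> F \<times> topspace Y)"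
    using assms by (intro closedin_Int) (auto simp: closedin_prod_Times_iff)
  moreover have "closed_map (prod_topology X Y) Y snd"
    using assms(1) closed_map_snd by blast
  ultimately have "closedin Y (snd ` (R \<inter> F \<times> topspace Y))"
    unfolding closed_map_def by blast
  moreover have "R \<subseteq> topspace X \<times> topspace Y"
    using closedin_subset[OF assms(2)] by simp
  then have "snd ` (R \<inter> F \<times> topspace Y) = R `` F"
    by force
  ultimately show ?thesis by simp
qed

text \<open>For an equivalence relation these are the closed sets of the quotient by
  \<open>R\<close>, pulled back to \<open>X\<close>.\<close>

definition saturated_closed :: "'a topology \<Rightarrow> ('a \<times> 'a) set \<Rightarrow> 'a set \<Rightarrow> bool" where
  "saturated_closed X R F \<longleftrightarrow> closedin X F \<and> R `` F \<subseteq> F"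

text \<open>It takes a pair because the iteration below carries both sets as one state.\<close>

definition saturated_disjoint :: "'a topology \<Rightarrow> ('a \<times> 'a) set \<Rightarrow> 'a set \<times> 'a set \<Rightarrow> bool" where
  "saturated_disjoint X R p \<longleftrightarrow>
     saturated_closed X R (fst p) \<and> saturated_closed X R (snd p) \<and> fst p \<inter> snd p = {}"

text \<open>This is normality of the quotient, read in \<open>X\<close>. The open set in between is
  not asked to be saturated: openness serves only to make the union of a growing chain open.\<close>

lemma saturated_closed_neighbourhood:
  assumes X: "compact_space X" "Hausdorff_space X"
    and R: "equiv (topspace X) R" "closedin (prod_topology X X) R"
    and F: "saturated_closed X R F" and G: "saturated_closed X R G" and FG: "F \<inter> G = {}"
  shows "\<exists>U F'. openin X U \<and> F \<subseteq> U \<and> U \<subseteq> F' \<and> saturated_closed X R F' \<and> F' \<inter> G = {}"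
proof -
  have R_refl: "(x, x) \<in> R" if "x \<in> topspace X" for x
    using R(1) that by (auto simp: equiv_def refl_on_def)
  have R_sub: "R \<subseteq> topspace X \<times> topspace X"
    using closedin_subset[OF R(2)] by simp
  have R_sym: "(y, x) \<in> R" if "(x, y) \<in> R" for x y
    using R(1) that by (auto simp: equiv_def sym_def)
  have R_trans: "(x, z) \<in> R" if "(x, y) \<in> R" "(y, z) \<in> R" for x y z
    using R(1) that by (meson equivE transD)
  have normal: "normal_space X"
    using X compact_Hausdorff_or_regular_imp_normal_space by blast
  have cl: "closedin X F" "closedin X G"
    using F G by (auto simp: saturated_closed_def)
  obtain V W where V: "openin X V" "openin X W" "F \<subseteq> V" "G \<subseteq> W" "disjnt V W"
    using normal cl FG unfolding normal_space_def disjnt_def by meson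
  \<comment> \<open>\<open>V\<close> need not be saturated. The complement of \<open>C\<close> is
    the largest saturated set inside \<open>V\<close>; it is open, and it contains \<open>F\<close>
    because \<open>F\<close> is saturated.\<close>
  define C where "C = R `` (topspace X - V)"
  have C: "closedin X C" unfolding C_def using X R V by (intro closedin_Image) auto
  have FC: "F \<inter> C = {}"
  proof -
    have "z \<in> V" if "(z, x) \<in> R" "x \<in> F" for x z
      using that F V R_sym unfolding saturated_closed_def by blast
    then show ?thesis unfolding C_def by auto
  qed
  obtain U' V' where U: "openin X U'" "openin X V'" "F \<subseteq> U'" "C \<subseteq> V'" "disjnt U' V'"
    using normal cl C FC unfolding normal_space_def disjnt_def by meson
  define F' where "F' = R `` (topspace X - V')"
  have U_sub: "U' \<subseteq> topspace X - V'"
    using U openin_subset[of X U'] by (auto simp: disjnt_def)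
  have "U' \<subseteq> F'"
    unfolding F'_def using U_sub R_refl by blast
  moreover have "closedin X F'"
    unfolding F'_def using X R U by (intro closedin_Image) auto
  moreover have "R `` F' \<subseteq> F'"
    unfolding F'_def using R_trans by blast
  moreover have "F' \<inter> G = {}"
  proof -
    \<comment> \<open>A point equivalent to one of \<open>G\<close> is equivalent to a point outside
      \<open>V\<close>, so it lies in \<open>C\<close> and hence in \<open>V'\<close>. The
      saturation of the complement of \<open>V'\<close> therefore misses \<open>G\<close>.\<close>
    have "x \<in> V'" if xz: "(x, z) \<in> R" "z \<in> G" for x z
    proof -
      have "z \<in> topspace X - V" using that V R_sub by (auto simp: disjnt_def)
      then show ?thesis using xz R_sym U(4) unfolding C_def by blast
    qed
    then show ?thesis unfolding F'_def by auto
  qed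
  ultimately show ?thesis
    using U unfolding saturated_closed_def by blast
qed

text \<open>
  This is the countable sum theorem for zero-dimensional spaces, applied to the quotient of \<open>X\<close>
  by \<open>R\<close> without forming that quotient.
\<close>

lemma clopen_saturated_separation:
  fixes A :: "nat \<Rightarrow> 'a set"
  assumes X: "compact_space X" "Hausdorff_space X"
    and R: "equiv (topspace X) R" "closedin (prod_topology X X) R"
    and cover: "topspace X \<subseteq> (\<Union>k. A k)"
    and piece: "\<And>k F G. saturated_disjoint X R (F, G) \<Longrightarrow>
      \<exists>P Q. closedin X P \<and> closedin X Q \<and> A k \<subseteq> P \<union> Q \<and> P \<inter> G = {} \<and> Q \<inter> F = {} \<and> R `` P \<inter> Q = {}"
    and FG: "saturated_disjoint X R (F, G)"
  shows "\<exists>K. openin X K \<and> closedin X K \<and> R `` K \<subseteq> K \<and> F \<subseteq> K \<and> K \<inter> G = {}"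
proof -
  have R_refl: "(x, x) \<in> R" if "x \<in> topspace X" for x
    using R(1) that by (auto simp: equiv_def refl_on_def)
  have R_sym: "(y, x) \<in> R" if "(x, y) \<in> R" for x y
    using R(1) that by (auto simp: equiv_def sym_def)
  have R_trans: "(x, z) \<in> R" if "(x, y) \<in> R" "(y, z) \<in> R" for x y z
    using R(1) that by (meson equivE transD)
  \<comment> \<open>Each set of \<open>q\<close> is a neighbourhood of the corresponding set of
    \<open>p\<close>, which makes the unions of the chain open. The pair at stage
    \<open>Suc k\<close> takes care of \<open>A k\<close>.\<close>
  define step where "step k p q \<longleftrightarrow> (\<exists>U V. openin X U \<and> openin X V \<and> fst p \<subseteq> U \<and> U \<subseteq> fst q \<and>
      snd p \<subseteq> V \<and> V \<subseteq> snd q) \<and> A k \<subseteq> fst q \<union> snd q" for k :: nat and p q :: "'a set \<times> 'a set"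
  have step_ex: "\<exists>q. saturated_disjoint X R q \<and> step k p q"
    if p: "saturated_disjoint X R p" for k p
  proof -
    obtain F G where pFG: "p = (F, G)" by (cases p)
    then have good: "saturated_closed X R F" "saturated_closed X R G" "F \<inter> G = {}"
      using p by (auto simp: saturated_disjoint_def)
    have FR: "y \<in> F" if "x \<in> F" "(x, y) \<in> R" for x y
      using good that unfolding saturated_closed_def by blast
    have GR: "y \<in> G" if "x \<in> G" "(x, y) \<in> R" for x y
      using good that unfolding saturated_closed_def by blast
    obtain P Q where P: "closedin X P" "closedin X Q" "A k \<subseteq> P \<union> Q" "P \<inter> G = {}" "Q \<inter> F = {}"
        "R `` P \<inter> Q = {}"
      using piece[of F G k] p pFG by blast
    have PR: "(x, y) \<in> R \<Longrightarrow> x \<in> P \<Longrightarrow> y \<notin> Q" for x y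
      using P(6) by blast
    have PQ_sub: "P \<subseteq> topspace X" "Q \<subseteq> topspace X" using P closedin_subset by blast+
    \<comment> \<open>\<open>P\<close> and \<open>Q\<close> are saturated only now. Since no point
      of \<open>P\<close> is related to a point of \<open>Q\<close>, symmetry and transitivity make
      the two saturations disjoint; the saturated sets \<open>G\<close> and \<open>F\<close> avoid
      them because they avoid \<open>P\<close> and \<open>Q\<close>.\<close>
    define F1 where "F1 = F \<union> R `` P"
    define G1 where "G1 = G \<union> R `` Q"
    have F1: "saturated_closed X R F1"
      unfolding saturated_closed_def
    proof
      show "closedin X F1"
        unfolding F1_def using good P closedin_Image[OF X(1) R(2)]
        by (simp add: saturated_closed_def closedin_Un)
      show "R `` F1 \<subseteq> F1"
        unfolding F1_def using FR R_trans by (auto, meson ImageI)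
    qed
    have G1: "saturated_closed X R G1"
      unfolding saturated_closed_def
    proof
      show "closedin X G1"
        unfolding G1_def using good P closedin_Image[OF X(1) R(2)]
        by (simp add: saturated_closed_def closedin_Un)
      show "R `` G1 \<subseteq> G1"
        unfolding G1_def using GR R_trans by (auto, meson ImageI)
    qed
    have False if "x \<in> P" "(x, z) \<in> R" "y \<in> Q" "(y, z) \<in> R" for x y z
      using PR[OF R_trans[OF that(2) R_sym[OF that(4)]]] that by blast
    then have "R `` P \<inter> R `` Q = {}" by blast
    moreover have False if "x \<in> Q" "(x, y) \<in> R" "y \<in> F" for x y
      using FR[OF that(3) R_sym[OF that(2)]] that P(5) by blast
    then have "F \<inter> R `` Q = {}" by blast
    moreover have False if "x \<in> P" "(x, y) \<in> R" "y \<in> G" for x y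
      using GR[OF that(3) R_sym[OF that(2)]] that P(4) by blast
    then have "R `` P \<inter> G = {}" by blast
    ultimately have disj: "F1 \<inter> G1 = {}"
      unfolding F1_def G1_def using good(3) by blast
    obtain U F2 where U: "openin X U" "F1 \<subseteq> U" "U \<subseteq> F2" "saturated_closed X R F2" "F2 \<inter> G1 = {}"
      using saturated_closed_neighbourhood[OF X R F1 G1 disj] by blast
    have "G1 \<inter> F2 = {}" using U by blast
    then obtain V G2 where V: "openin X V" "G1 \<subseteq> V" "V \<subseteq> G2" "saturated_closed X R G2" "G2 \<inter> F2 = {}"
      using saturated_closed_neighbourhood[OF X R G1 U(4)] by blast
    have "P \<subseteq> R `` P" "Q \<subseteq> R `` Q" using PQ_sub R_refl by blast+
    then have "A k \<subseteq> F2 \<union> G2"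
      using P(3) U V unfolding F1_def G1_def by blast
    moreover have "F \<subseteq> U" "G \<subseteq> V" using U V unfolding F1_def G1_def by blast+
    ultimately have "step k p (F2, G2)"
      unfolding step_def pFG using U V by auto
    moreover have "saturated_disjoint X R (F2, G2)"
      using U V unfolding saturated_disjoint_def by auto
    ultimately show ?thesis by blast
  qed
  \<comment> \<open>Dependent choice; the clause for \<open>k = 0\<close> fixes the starting
    pair.\<close>
  have "\<exists>f. \<forall>k. (saturated_disjoint X R (f k) \<and> (k = 0 \<longrightarrow> f k = (F, G))) \<and> step k (f k) (f (Suc k))"
  proof (rule dependent_nat_choice)
    show "\<exists>p. saturated_disjoint X R p \<and> ((0::nat) = 0 \<longrightarrow> p = (F, G))" using FG by blast
  next
    fix p and k :: nat assume "saturated_disjoint X R p \<and> (k = 0 \<longrightarrow> p = (F, G))"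
    then show "\<exists>q. (saturated_disjoint X R q \<and> (Suc k = 0 \<longrightarrow> q = (F, G))) \<and> step k p q"
      using step_ex[of p k] by simp
  qed
  then obtain f where f': "\<forall>k. (saturated_disjoint X R (f k) \<and> (k = 0 \<longrightarrow> f k = (F, G))) \<and> step k (f k) (f (Suc k))"
    by (elim exE)
  then have f: "saturated_disjoint X R (f k)" "f 0 = (F, G)" "step k (f k) (f (Suc k))" for k
    by simp_all
  define K where "K = (\<Union>k. fst (f k))"
  define L where "L = (\<Union>k. snd (f k))"
  have mono: "fst (f i) \<subseteq> fst (f j)" "snd (f i) \<subseteq> snd (f j)" if "i \<le> j" for i j
  proof -
    have "fst (f k) \<subseteq> fst (f (Suc k))" "snd (f k) \<subseteq> snd (f (Suc k))" for k
      using f(3)[of k] unfolding step_def by blast+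
    note steps = this
    show "fst (f i) \<subseteq> fst (f j)"
      by (rule lift_Suc_mono_le[of "\<lambda>k. fst (f k)", OF steps(1) that])
    show "snd (f i) \<subseteq> snd (f j)"
      by (rule lift_Suc_mono_le[of "\<lambda>k. snd (f k)", OF steps(2) that])
  qed
  have "openin X K"
    unfolding openin_subopen[of X K]
  proof
    fix x assume "x \<in> K"
    then obtain k where "x \<in> fst (f k)" unfolding K_def by blast
    then obtain U where "openin X U" "x \<in> U" "U \<subseteq> fst (f (Suc k))"
      using f(3)[of k] unfolding step_def by blast
    then show "\<exists>T. openin X T \<and> x \<in> T \<and> T \<subseteq> K" unfolding K_def by blast
  qed
  moreover have "openin X L"
    unfolding openin_subopen[of X L]
  proof
    fix x assume "x \<in> L"
    then obtain k where "x \<in> snd (f k)" unfolding L_def by blast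
    then obtain U where "openin X U" "x \<in> U" "U \<subseteq> snd (f (Suc k))"
      using f(3)[of k] unfolding step_def by blast
    then show "\<exists>T. openin X T \<and> x \<in> T \<and> T \<subseteq> L" unfolding L_def by blast
  qed
  moreover have "K \<inter> L = {}"
  proof -
    have "fst (f i) \<inter> snd (f j) = {}" for i j
      using mono[of i "max i j"] mono[of j "max i j"] f(1)[of "max i j"]
      unfolding saturated_disjoint_def by auto
    then show ?thesis unfolding K_def L_def by blast
  qed
  moreover have "topspace X \<subseteq> K \<union> L"
  proof
    fix x assume "x \<in> topspace X"
    then obtain k where "x \<in> A k" using cover by blast
    then show "x \<in> K \<union> L" using f(3)[of k] unfolding step_def K_def L_def by blast
  qed
  \<comment> \<open>Two disjoint open sets that cover the space are complements of each other, so
    \<open>K\<close> is closed as well.\<close>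
  ultimately have "K = topspace X - L"
    using openin_subset[of X K] by blast
  then have "closedin X K" using \<open>openin X L\<close> by blast
  moreover have "R `` fst (f k) \<subseteq> fst (f k)" for k
    using f(1)[of k] unfolding saturated_disjoint_def saturated_closed_def by blast
  then have "R `` K \<subseteq> K" unfolding K_def by blast
  moreover have "F = fst (f 0)" "G = snd (f 0)"
    using f(2) by simp_all
  then have "F \<subseteq> K" "G \<subseteq> L" unfolding K_def L_def by blast+
  ultimately show ?thesis using \<open>openin X K\<close> \<open>K \<inter> L = {}\<close> by blast
qed

section \<open>Congruences of finite index\<close>

lemma FCM_add [simp, intro]: "a \<in> FCM n \<Longrightarrow> b \<in> FCM n \<Longrightarrow> fcm_add a b \<in> FCM n"
  by (simp add: FCM_def fcm_add_def)

lemma FCM_zero [simp, intro]: "fcm_zero \<in> FCM n"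
  by (simp add: FCM_def fcm_zero_def)

lemma fcm_add_assoc: "fcm_add (fcm_add a b) c = fcm_add a (fcm_add b c)"
  by (simp add: fcm_add_def add.assoc)

lemma fcm_add_commute: "fcm_add a b = fcm_add b a"
  by (simp add: fcm_add_def add.commute)

lemma fcm_add_zero [simp]: "fcm_add fcm_zero a = a" "fcm_add a fcm_zero = a"
  by (simp_all add: fcm_add_def fcm_zero_def)

lemma
  assumes "\<theta> \<in> Cong n"
  shows Cong_equiv: "equiv (FCM n) \<theta>"
    and Cong_add: "(a, b) \<in> \<theta> \<Longrightarrow> (c, d) \<in> \<theta> \<Longrightarrow> (fcm_add a c, fcm_add b d) \<in> \<theta>"
    and Cong_finite: "finite (FCM n // \<theta>)"
  using assms by (auto simp: Cong_def)

lemma Cong_sub: "\<theta> \<in> Cong n \<Longrightarrow> (a, b) \<in> \<theta> \<Longrightarrow> a \<in> FCM n \<and> b \<in> FCM n"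
  using Cong_equiv by (auto simp: equiv_def)

lemma Cong_refl: "\<theta> \<in> Cong n \<Longrightarrow> a \<in> FCM n \<Longrightarrow> (a, a) \<in> \<theta>"
  using Cong_equiv by (auto simp: equiv_def refl_on_def)

lemma Cong_sym: "\<theta> \<in> Cong n \<Longrightarrow> (a, b) \<in> \<theta> \<Longrightarrow> (b, a) \<in> \<theta>"
  using Cong_equiv by (auto simp: equiv_def sym_def)

lemma Cong_trans: "\<theta> \<in> Cong n \<Longrightarrow> (a, b) \<in> \<theta> \<Longrightarrow> (b, c) \<in> \<theta> \<Longrightarrow> (a, c) \<in> \<theta>"
  using Cong_equiv by (meson equivE transD)

lemma Cong_class_eq:
  "\<theta> \<in> Cong n \<Longrightarrow> a \<in> FCM n \<Longrightarrow> b \<in> FCM n \<Longrightarrow> \<theta> `` {a} = \<theta> `` {b} \<longleftrightarrow> (a, b) \<in> \<theta>"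
  using eq_equiv_class_iff[OF Cong_equiv] by blast

text \<open>Compatibility in one argument suffices, because by commutativity the two summands can be
  replaced one after the other. Truncations, intersections and preimages of congruences all arise as
  such kernels.\<close>

lemma Cong_kernel:
  assumes fin: "finite (g ` FCM n)"
    and add: "\<And>a b c. a \<in> FCM n \<Longrightarrow> b \<in> FCM n \<Longrightarrow> c \<in> FCM n \<Longrightarrow> g a = g b \<Longrightarrow>
      g (fcm_add a c) = g (fcm_add b c)"
  shows "{(a, b). a \<in> FCM n \<and> b \<in> FCM n \<and> g a = g b} \<in> Cong n" (is "?\<theta> \<in> _")
  unfolding Cong_def
proof (rule CollectI, intro conjI allI impI)
  show "equiv (FCM n) ?\<theta>"
    by (auto simp: equiv_def refl_on_def sym_def trans_def)
  fix a b c d assume ab: "(a, b) \<in> ?\<theta>" and cd: "(c, d) \<in> ?\<theta>"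
  then have "g (fcm_add a c) = g (fcm_add b c)" "g (fcm_add b c) = g (fcm_add b d)"
    using add[of a b c] add[of c d b] by (auto simp: fcm_add_commute)
  then show "(fcm_add a c, fcm_add b d) \<in> ?\<theta>" using ab cd by auto
next
  have "FCM n // ?\<theta> \<subseteq> (\<lambda>v. {b \<in> FCM n. v = g b}) ` (g ` FCM n)"
    by (auto simp: quotient_def)
  then show "finite (FCM n // ?\<theta>)" using fin finite_subset by blast
qed

lemma Cong_coarser:
  assumes "\<theta> \<in> Cong n" "\<theta> \<subseteq> \<sigma>" "equiv (FCM n) \<sigma>"
    and "\<And>a b c d. (a, b) \<in> \<sigma> \<Longrightarrow> (c, d) \<in> \<sigma> \<Longrightarrow> (fcm_add a c, fcm_add b d) \<in> \<sigma>"
  shows "\<sigma> \<in> Cong n"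
  using assms finite_refines_finite[OF Cong_finite[OF assms(1)] assms(2) Cong_equiv[OF assms(1)] assms(3)]
  by (simp add: Cong_def)

lemma Cong_Int:
  assumes "\<theta> \<in> Cong n" "\<theta>' \<in> Cong n"
  shows "\<theta> \<inter> \<theta>' \<in> Cong n"
proof -
  let ?g = "\<lambda>a. (\<theta> `` {a}, \<theta>' `` {a})"
  have "?g ` FCM n \<subseteq> (FCM n // \<theta>) \<times> (FCM n // \<theta>')"
    by (auto intro: quotientI)
  then have fin: "finite (?g ` FCM n)"
    using assms by (meson Cong_finite finite_SigmaI finite_subset)
  have key: "(a \<in> FCM n \<and> b \<in> FCM n \<and> \<theta> `` {a} = \<theta> `` {b} \<and> \<theta>' `` {a} = \<theta>' `` {b}) \<longleftrightarrow>
      (a, b) \<in> \<theta> \<and> (a, b) \<in> \<theta>'" for a b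
    using Cong_class_eq[OF assms(1)] Cong_class_eq[OF assms(2)] Cong_sub[OF assms(1)] by metis
  have "{(a, b). a \<in> FCM n \<and> b \<in> FCM n \<and> ?g a = ?g b} = \<theta> \<inter> \<theta>'"
    unfolding prod.inject key by auto
  moreover have "{(a, b). a \<in> FCM n \<and> b \<in> FCM n \<and> ?g a = ?g b} \<in> Cong n"
  proof (rule Cong_kernel[OF fin])
    fix a b c assume abc: "a \<in> FCM n" "b \<in> FCM n" "c \<in> FCM n" and "?g a = ?g b"
    then have "(a, b) \<in> \<theta>" "(a, b) \<in> \<theta>'" using assms by (auto simp: Cong_class_eq)
    then show "?g (fcm_add a c) = ?g (fcm_add b c)"
      using assms abc by (simp add: Cong_class_eq Cong_add Cong_refl)
  qed
  ultimately show ?thesis by simp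
qed

lemma Cong_full: "FCM n \<times> FCM n \<in> Cong n"
proof -
  have "{(a, b). a \<in> FCM n \<and> b \<in> FCM n \<and> () = ()} \<in> Cong n"
    by (rule Cong_kernel) auto
  moreover have "{(a, b). a \<in> FCM n \<and> b \<in> FCM n \<and> () = ()} = FCM n \<times> FCM n" by auto
  ultimately show ?thesis by simp
qed

text \<open>Lets finitely many conditions on a point of \<open>Omega n\<close> be replaced by one
  condition at a single finite level.\<close>

lemma Cong_directed:
  assumes "finite J" "J \<subseteq> Cong n"
  shows "\<exists>\<theta>\<in>Cong n. \<forall>\<theta>'\<in>J. \<theta> \<subseteq> \<theta>'"
  using assms
proof (induction J)
  case empty
  then show ?case using Cong_full by blast
next
  case (insert \<theta>' J)
  then obtain \<theta> where "\<theta> \<in> Cong n" "\<forall>\<theta>''\<in>J. \<theta> \<subseteq> \<theta>''" by auto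
  then show ?case using insert Cong_Int[of \<theta> n \<theta>'] by (intro bexI[of _ "\<theta> \<inter> \<theta>'"]) auto
qed

section \<open>Thresholds and periods of congruences of finite index\<close>

definition fcm_gen :: "nat \<Rightarrow> nat \<Rightarrow> fcm" where
  "fcm_gen i k = (\<lambda>j. if j = i then k else 0)"

lemma fcm_gen_FCM [simp]: "i < n \<Longrightarrow> fcm_gen i k \<in> FCM n"
  by (auto simp: fcm_gen_def FCM_def)

lemma fcm_gen_add: "fcm_add (fcm_gen i k) (fcm_gen i l) = fcm_gen i (k + l)"
  by (auto simp: fcm_gen_def fcm_add_def)

text \<open>Pigeonhole: two powers of the generator, with exponents \<open>k < l\<close>, fall into
  one class. Adding a further power to both makes the powers periodic from \<open>k\<close> on, with
  period \<open>l - k\<close>.\<close>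

lemma Cong_gen_period:
  assumes \<theta>: "\<theta> \<in> Cong n" and i: "i < n"
  shows "\<exists>t p. p \<ge> 1 \<and> (\<forall>k\<ge>t. \<forall>q. (fcm_gen i k, fcm_gen i (k + q * p)) \<in> \<theta>)"
proof -
  let ?c = "\<lambda>k. \<theta> `` {fcm_gen i k}"
  have "range ?c \<subseteq> FCM n // \<theta>" using i by (auto intro: quotientI)
  then have "finite (range ?c)" using Cong_finite[OF \<theta>] finite_subset by blast
  then have "\<not> inj ?c" using finite_imageD by blast
  then have "\<exists>k l. k < l \<and> ?c k = ?c l"
    using linorder_injI[of ?c] by blast
  then obtain k l where "k < l" "?c k = ?c l" by blast
  then have kl: "(fcm_gen i k, fcm_gen i l) \<in> \<theta>" using \<theta> i by (simp add: Cong_class_eq)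
  define p where "p = l - k"
  have step: "(fcm_gen i m, fcm_gen i (m + p)) \<in> \<theta>" if "m \<ge> k" for m
    using Cong_add[OF \<theta> kl Cong_refl[OF \<theta> fcm_gen_FCM[OF i]], of "m - k"] that \<open>k < l\<close>
    by (simp add: fcm_gen_add p_def add.commute)
  have "(fcm_gen i m, fcm_gen i (m + q * p)) \<in> \<theta>" if "m \<ge> k" for m q
  proof (induction q)
    case 0
    then show ?case using \<theta> i by (simp add: Cong_refl)
  next
    case (Suc q)
    have "(fcm_gen i (m + q * p), fcm_gen i (m + q * p + p)) \<in> \<theta>"
      using step[of "m + q * p"] that by simp
    then show ?case using Cong_trans[OF \<theta> Suc] by (simp add: algebra_simps)
  qed
  moreover have "p \<ge> 1" using \<open>k < l\<close> by (simp add: p_def)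
  ultimately show ?thesis by blast
qed

lemma Cong_coordinatewise:
  assumes \<theta>: "\<theta> \<in> Cong n" and a: "a \<in> FCM n" and b: "b \<in> FCM n"
    and ab: "\<And>i. i < n \<Longrightarrow> (fcm_gen i (a i), fcm_gen i (b i)) \<in> \<theta>"
  shows "(a, b) \<in> \<theta>"
proof -
  have "((\<lambda>j. if j < m then a j else 0), (\<lambda>j. if j < m then b j else 0)) \<in> \<theta>" if "m \<le> n" for m
    using that
  proof (induction m)
    case 0
    then show ?case using Cong_refl[OF \<theta> FCM_zero] by (simp add: fcm_zero_def)
  next
    case (Suc m)
    have eq: "fcm_add (\<lambda>j. if j < m then c j else 0) (fcm_gen m (c m)) =
        (\<lambda>j. if j < Suc m then c j else 0)" for c
      by (auto simp: fcm_add_def fcm_gen_def less_Suc_eq)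
    show ?case using Cong_add[OF \<theta> Suc.IH ab[of m]] Suc.prems by (simp add: eq)
  qed
  from this[of n] have "((\<lambda>j. if j < n then a j else 0), (\<lambda>j. if j < n then b j else 0)) \<in> \<theta>" by simp
  moreover have "(\<lambda>j. if j < n then c j else 0) = c" if "c \<in> FCM n" for c
    using that by (auto simp: FCM_def fun_eq_iff)
  ultimately show ?thesis using a b by simp
qed

text \<open>Uniform bounds come from the largest threshold and the product of the periods of the
  single generators. They describe the finite levels of N + Z^ in each coordinate.\<close>

lemma Cong_threshold_period:
  assumes \<theta>: "\<theta> \<in> Cong n"
  shows "\<exists>t p. p \<ge> 1 \<and> (\<forall>a b. a \<in> FCM n \<longrightarrow> b \<in> FCM n \<longrightarrow>
    (\<forall>i<n. a i = b i \<or> a i \<ge> t \<and> (\<exists>q. b i = a i + q * p)) \<longrightarrow> (a, b) \<in> \<theta>)"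
proof -
  obtain t p where tp: "\<And>i. i < n \<Longrightarrow> p i \<ge> 1"
      "\<And>i k q. i < n \<Longrightarrow> k \<ge> t i \<Longrightarrow> (fcm_gen i k, fcm_gen i (k + q * p i)) \<in> \<theta>"
  proof -
    let ?P = "\<lambda>i s. i < n \<longrightarrow> snd s \<ge> 1 \<and>
      (\<forall>k\<ge>fst s. \<forall>q. (fcm_gen i k, fcm_gen i (k + q * snd s)) \<in> \<theta>)"
    have "\<exists>s. ?P i s" for i
      using Cong_gen_period[OF \<theta>, of i] by auto
    then have "\<exists>s. \<forall>i. ?P i (s i)" by (intro choice allI)
    then obtain s where "\<forall>i. ?P i (s i)" ..
    then show thesis using that[of "snd \<circ> s" "fst \<circ> s"] by auto
  qed
  \<comment> \<open>\<open>insert 0\<close> keeps \<open>Max\<close> meaningful for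
    \<open>n = 0\<close>.\<close>
  define T where "T = Max (insert 0 (t ` {..<n}))"
  define P where "P = (\<Prod>i<n. p i)"
  have "P \<ge> 1" unfolding P_def using prod_pos[of "{..<n}" p] tp(1) by (force simp: Suc_le_eq)
  moreover have "(a, b) \<in> \<theta>" if ab: "a \<in> FCM n" "b \<in> FCM n"
    "\<forall>i<n. a i = b i \<or> a i \<ge> T \<and> (\<exists>q. b i = a i + q * P)" for a b
  proof (rule Cong_coordinatewise[OF \<theta> ab(1,2)])
    fix i assume i: "i < n"
    have "t i \<le> T" unfolding T_def using i by auto
    have "p i dvd P" unfolding P_def using i by (simp add: dvd_prodI)
    then obtain r where r: "P = p i * r" by (auto simp: dvd_def)
    show "(fcm_gen i (a i), fcm_gen i (b i)) \<in> \<theta>"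
      using ab(3) i
    proof (elim allE[of _ i] impE disjE conjE exE)
      assume "a i = b i"
      then show ?thesis using \<theta> i by (simp add: Cong_refl)
    next
      fix q assume "a i \<ge> T" and q: "b i = a i + q * P"
      then have "(fcm_gen i (a i), fcm_gen i (a i + (q * r) * p i)) \<in> \<theta>"
        using tp(2)[OF i, of "a i" "q * r"] \<open>t i \<le> T\<close> by simp
      then show ?thesis using q r by (simp add: algebra_simps)
    qed
  qed
  ultimately show ?thesis by blast
qed

text \<open>The quotient is the \<open>n\<close>-th power of the monoid {0..t} with addition
  truncated at \<open>t\<close>. As \<open>t\<close> grows, these quotients detect exactly the
  degree of each coordinate, finite or infinite.\<close>

definition cap_cong :: "nat \<Rightarrow> nat \<Rightarrow> (fcm \<times> fcm) set" where
  "cap_cong n t = {(a, b). a \<in> FCM n \<and> b \<in> FCM n \<and> (\<lambda>i. min (a i) t) = (\<lambda>i. min (b i) t)}"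

lemma cap_cong_iff:
  "(a, b) \<in> cap_cong n t \<longleftrightarrow> a \<in> FCM n \<and> b \<in> FCM n \<and> (\<forall>i. min (a i) t = min (b i) t)"
  by (simp add: cap_cong_def fun_eq_iff)

lemma min_add_cong_nat:
  fixes x y z t :: nat
  assumes "min x t = min y t"
  shows "min (x + z) t = min (y + z) t"
  using assms by (simp add: min_def split: if_splits)

lemma cap_cong_Cong: "cap_cong n t \<in> Cong n"
  unfolding cap_cong_def
proof (rule Cong_kernel)
  have "(\<lambda>a i. min (a i) t) ` FCM n \<subseteq> {f. \<forall>i. (i \<in> {..<n} \<longrightarrow> f i \<in> {..t}) \<and> (i \<notin> {..<n} \<longrightarrow> f i = 0)}"
    by (auto simp: FCM_def)
  then show "finite ((\<lambda>a i. min (a i) t) ` FCM n)"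
    by (rule finite_subset) (rule finite_set_of_finite_funs; simp)
next
  fix a b c :: fcm
  assume "(\<lambda>i. min (a i) t) = (\<lambda>i. min (b i) t)"
  then have "min (a i) t = min (b i) t" for i by (rule fun_cong)
  then have "min (a i + c i) t = min (b i + c i) t" for i
    using min_add_cong_nat by blast
  then show "(\<lambda>i. min (fcm_add a c i) t) = (\<lambda>i. min (fcm_add b c i) t)"
    by (simp only: fcm_add_def)
qed

text \<open>Divisibility at a finite level. With \<open>t\<close> a threshold of \<theta>, exponents
  below \<open>t\<close> are equal, and exponents from \<open>t\<close> on matter only modulo the
  period, where subtraction is possible.\<close>

lemma cap_cong_imp_solvable:
  assumes \<theta>: "\<theta> \<in> Cong n"
  shows "\<exists>t. \<forall>a b. (a, b) \<in> cap_cong n t \<longrightarrow> (\<exists>c\<in>FCM n. (fcm_add c a, b) \<in> \<theta>)"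
proof -
  obtain t p where p: "p \<ge> 1" and tp: "\<And>a b. a \<in> FCM n \<Longrightarrow> b \<in> FCM n \<Longrightarrow>
    (\<forall>i<n. a i = b i \<or> a i \<ge> t \<and> (\<exists>q. b i = a i + q * p)) \<Longrightarrow> (a, b) \<in> \<theta>"
    using Cong_threshold_period[OF \<theta>] by blast
  have "\<exists>c\<in>FCM n. (fcm_add c a, b) \<in> \<theta>" if ab: "(a, b) \<in> cap_cong n t" for a b
  proof -
    have F: "a \<in> FCM n" "b \<in> FCM n" and m: "\<And>i. min (a i) t = min (b i) t"
      using ab by (auto simp: cap_cong_iff)
    \<comment> \<open>\<open>a i * p\<close> is a multiple of the period and, as
      \<open>p \<ge> 1\<close>, at least \<open>a i\<close>. So the subtraction is not cut off at 0,
      and adding \<open>a i\<close> again gives \<open>b i\<close> up to a multiple of the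
      period.\<close>
    define c where "c = (\<lambda>i. if a i < t then 0 else b i + a i * p - a i)"
    have eq: "a i < t \<Longrightarrow> b i = a i" "a i \<ge> t \<Longrightarrow> b i \<ge> t" for i
      using m[of i] by linarith+
    have le: "a i \<le> a i * p" for i using p by simp
    have c: "c \<in> FCM n" using F by (simp add: c_def FCM_def)
    have "(b, fcm_add c a) \<in> \<theta>"
    proof (rule tp)
      show "\<forall>i<n. b i = fcm_add c a i \<or> b i \<ge> t \<and> (\<exists>q. fcm_add c a i = b i + q * p)"
      proof (intro allI impI)
        fix i
        show "b i = fcm_add c a i \<or> b i \<ge> t \<and> (\<exists>q. fcm_add c a i = b i + q * p)"
        proof (cases "a i < t")
          case True
          then show ?thesis using eq by (simp add: c_def fcm_add_def)
        next
          case False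
          then have "fcm_add c a i = b i + a i * p"
            using trans_le_add2[OF le[of i], of "b i"]
            by (simp add: c_def fcm_add_def del: mult_le_cancel1 mult_le_mono1)
          then show ?thesis using False eq by auto
        qed
      qed
    qed (use c F in auto)
    then show ?thesis using c Cong_sym[OF \<theta>] by blast
  qed
  then show ?thesis by blast
qed

section \<open>The free profinite commutative monoid\<close>

lemma Omega_app: "x \<in> Omega n \<Longrightarrow> \<theta> \<in> Cong n \<Longrightarrow> x \<theta> \<in> FCM n // \<theta>"
  by (auto simp: Omega_def PiE_def Pi_def)

lemma Omega_mono: "x \<in> Omega n \<Longrightarrow> \<theta> \<in> Cong n \<Longrightarrow> \<theta>' \<in> Cong n \<Longrightarrow> \<theta> \<subseteq> \<theta>' \<Longrightarrow> x \<theta> \<subseteq> x \<theta>'"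
  by (auto simp: Omega_def)

lemma Omega_rep:
  assumes "x \<in> Omega n" "\<theta> \<in> Cong n"
  obtains a where "a \<in> FCM n" "a \<in> x \<theta>"
  using Omega_app[OF assms] Cong_refl[OF assms(2)] by (auto simp: quotient_def)

lemma Omega_class:
  assumes "x \<in> Omega n" "\<theta> \<in> Cong n" "a \<in> x \<theta>"
  shows "x \<theta> = \<theta> `` {a}"
  using Omega_app[OF assms(1,2)] assms(3) equiv_class_eq[OF Cong_equiv[OF assms(2)]]
  by (auto simp: quotient_def)

lemma Omega_FCM:
  assumes "x \<in> Omega n" "\<theta> \<in> Cong n" "a \<in> x \<theta>"
  shows "a \<in> FCM n"
  using Omega_app[OF assms(1,2)] assms(3) Cong_sub[OF assms(2)] by (auto simp: quotient_def)

lemma Omega_rel: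
  assumes "x \<in> Omega n" "\<theta> \<in> Cong n" "a \<in> x \<theta>"
  shows "b \<in> x \<theta> \<longleftrightarrow> (a, b) \<in> \<theta>"
  using Omega_class[OF assms] by blast

lemma Omega_eq_iff:
  assumes "x \<in> Omega n" "y \<in> Omega n" "\<theta> \<in> Cong n" "a \<in> x \<theta>"
  shows "x \<theta> = y \<theta> \<longleftrightarrow> a \<in> y \<theta>"
  using Omega_class[OF assms(1,3,4)] Omega_class[OF assms(2,3), of a] assms(4) by blast

text \<open>A representative modulo the intersection serves both congruences. Two finite levels can
  thus be compared through one element of the free monoid.\<close>

lemma Omega_rep2:
  assumes x: "x \<in> Omega n" and \<theta>: "\<theta> \<in> Cong n" "\<theta>' \<in> Cong n"
  obtains a where "a \<in> FCM n" "a \<in> x \<theta>" "a \<in> x \<theta>'"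
proof -
  have c: "\<theta> \<inter> \<theta>' \<in> Cong n" using \<theta> Cong_Int by blast
  obtain a where "a \<in> FCM n" "a \<in> x (\<theta> \<inter> \<theta>')" using Omega_rep[OF x c] .
  then show thesis using that Omega_mono[OF x c] \<theta> by blast
qed

lemma Omega_eq_finer:
  assumes x: "x \<in> Omega n" and y: "y \<in> Omega n" and \<theta>: "\<theta> \<in> Cong n" "\<theta>' \<in> Cong n" "\<theta> \<subseteq> \<theta>'"
    and eq: "x \<theta> = y \<theta>"
  shows "x \<theta>' = y \<theta>'"
proof -
  obtain a where a: "a \<in> x \<theta>" using Omega_rep[OF x \<theta>(1)] .
  then have "a \<in> x \<theta>'" "a \<in> y \<theta>'"
    using eq Omega_mono[OF x \<theta>] Omega_mono[OF y \<theta>] by auto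
  then show ?thesis using Omega_eq_iff[OF x y \<theta>(2)] by blast
qed

lemma Omega_eqI:
  assumes "x \<in> Omega n" "y \<in> Omega n" "\<And>\<theta>. \<theta> \<in> Cong n \<Longrightarrow> x \<theta> = y \<theta>"
  shows "x = y"
  using assms by (auto simp: Omega_def intro: PiE_ext)

lemma OmegaI:
  assumes "\<And>\<theta>. \<theta> \<in> Cong n \<Longrightarrow> c \<theta> \<in> FCM n"
    and "\<And>\<theta> \<theta>'. \<theta> \<in> Cong n \<Longrightarrow> \<theta>' \<in> Cong n \<Longrightarrow> \<theta> \<subseteq> \<theta>' \<Longrightarrow> (c \<theta>', c \<theta>) \<in> \<theta>'"
  shows "(\<lambda>\<theta>\<in>Cong n. \<theta> `` {c \<theta>}) \<in> Omega n"
proof -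
  have "\<theta> `` {c \<theta>} \<subseteq> \<theta>' `` {c \<theta>'}" if "\<theta> \<in> Cong n" "\<theta>' \<in> Cong n" "\<theta> \<subseteq> \<theta>'" for \<theta> \<theta>'
    using assms(2)[OF that] that Cong_trans[OF that(2)] by blast
  then show ?thesis
    using assms(1) by (auto simp: Omega_def intro!: quotientI)
qed

section \<open>The canonical map from the free monoid, and multiplication in the completion\<close>

definition om_of :: "nat \<Rightarrow> fcm \<Rightarrow> om" where
  "om_of n a = (\<lambda>\<theta>\<in>Cong n. \<theta> `` {a})"

lemma om_of_Omega [simp]: "a \<in> FCM n \<Longrightarrow> om_of n a \<in> Omega n"
  unfolding om_of_def by (rule OmegaI) (auto simp: Cong_refl)

lemma om_of_app [simp]: "\<theta> \<in> Cong n \<Longrightarrow> om_of n a \<theta> = \<theta> `` {a}"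
  by (simp add: om_of_def)

lemma om_of_rep: "\<theta> \<in> Cong n \<Longrightarrow> a \<in> FCM n \<Longrightarrow> a \<in> om_of n a \<theta>"
  by (simp add: Cong_refl)

lemma om_one_eq: "om_one n = om_of n fcm_zero"
  by (simp add: om_one_def om_of_def)

lemma om_one_Omega [simp]: "om_one n \<in> Omega n"
  by (simp add: om_one_eq)

text \<open>Frees \<open>om_mult\<close> from the \<open>SOME\<close> in its definition:
  compatibility of \<theta> with addition makes the class independent of the
  representatives.\<close>

lemma om_mult_app:
  assumes x: "x \<in> Omega n" and y: "y \<in> Omega n" and \<theta>: "\<theta> \<in> Cong n"
    and a: "a \<in> x \<theta>" and b: "b \<in> y \<theta>"
  shows "om_mult n x y \<theta> = \<theta> `` {fcm_add a b}"
proof -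
  let ?a = "SOME a. a \<in> x \<theta>" and ?b = "SOME b. b \<in> y \<theta>"
  have "?a \<in> x \<theta>" "?b \<in> y \<theta>" using a b someI[of "\<lambda>a. a \<in> x \<theta>"] someI[of "\<lambda>a. a \<in> y \<theta>"] by auto
  then have "(a, ?a) \<in> \<theta>" "(b, ?b) \<in> \<theta>"
    using Omega_rel[OF x \<theta> a] Omega_rel[OF y \<theta> b] by auto
  then have "(fcm_add a b, fcm_add ?a ?b) \<in> \<theta>" using Cong_add[OF \<theta>] by blast
  then have "\<theta> `` {fcm_add a b} = \<theta> `` {fcm_add ?a ?b}"
    using equiv_class_eq[OF Cong_equiv[OF \<theta>]] by blast
  then show ?thesis using \<theta> by (simp add: om_mult_def)
qed

lemma om_mult_rep:
  assumes "x \<in> Omega n" "y \<in> Omega n" "\<theta> \<in> Cong n" "a \<in> x \<theta>" "b \<in> y \<theta>"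
  shows "fcm_add a b \<in> om_mult n x y \<theta>"
proof -
  have "fcm_add a b \<in> FCM n" using assms Omega_FCM by blast
  then show ?thesis using om_mult_app[OF assms] Cong_refl[OF assms(3)] by blast
qed

lemma om_mult_Omega [simp]:
  assumes x: "x \<in> Omega n" and y: "y \<in> Omega n"
  shows "om_mult n x y \<in> Omega n"
  unfolding om_mult_def
proof (rule OmegaI)
  fix \<theta> assume \<theta>: "\<theta> \<in> Cong n"
  have "(SOME a. a \<in> x \<theta>) \<in> x \<theta>" "(SOME a. a \<in> y \<theta>) \<in> y \<theta>"
    using Omega_rep[OF x \<theta>] Omega_rep[OF y \<theta>] by (metis someI_ex)+
  note reps = this
  then show "fcm_add (SOME a. a \<in> x \<theta>) (SOME b. b \<in> y \<theta>) \<in> FCM n"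
    using Omega_FCM[OF x \<theta>] Omega_FCM[OF y \<theta>] by blast
  fix \<theta>' assume \<theta>': "\<theta>' \<in> Cong n" "\<theta> \<subseteq> \<theta>'"
  have "(SOME a. a \<in> x \<theta>') \<in> x \<theta>'" "(SOME a. a \<in> y \<theta>') \<in> y \<theta>'"
    using Omega_rep[OF x \<theta>'(1)] Omega_rep[OF y \<theta>'(1)] by (metis someI_ex)+
  moreover have "(SOME a. a \<in> x \<theta>) \<in> x \<theta>'" "(SOME a. a \<in> y \<theta>) \<in> y \<theta>'"
    using reps Omega_mono[OF x \<theta> \<theta>'] Omega_mono[OF y \<theta> \<theta>'] by auto
  ultimately show "(fcm_add (SOME a. a \<in> x \<theta>') (SOME b. b \<in> y \<theta>'),
      fcm_add (SOME a. a \<in> x \<theta>) (SOME b. b \<in> y \<theta>)) \<in> \<theta>'"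
    using Omega_rel[OF x \<theta>'(1)] Omega_rel[OF y \<theta>'(1)] Cong_add[OF \<theta>'(1)] by blast
qed

lemma om_mult_cong:
  assumes "x \<in> Omega n" "x' \<in> Omega n" "y \<in> Omega n" "\<theta> \<in> Cong n" "x \<theta> = x' \<theta>"
  shows "om_mult n x y \<theta> = om_mult n x' y \<theta>"
  using assms by (simp add: om_mult_def)

lemma om_mult_commute:
  assumes "x \<in> Omega n" "y \<in> Omega n"
  shows "om_mult n x y = om_mult n y x"
  unfolding om_mult_def by (simp add: fcm_add_commute)

lemma om_mult_assoc:
  assumes x: "x \<in> Omega n" and y: "y \<in> Omega n" and z: "z \<in> Omega n"
  shows "om_mult n (om_mult n x y) z = om_mult n x (om_mult n y z)"
proof (rule Omega_eqI)
  fix \<theta> assume \<theta>: "\<theta> \<in> Cong n"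
  obtain a b c where abc: "a \<in> x \<theta>" "b \<in> y \<theta>" "c \<in> z \<theta>"
    using Omega_rep[OF x \<theta>] Omega_rep[OF y \<theta>] Omega_rep[OF z \<theta>] by metis
  have "om_mult n (om_mult n x y) z \<theta> = \<theta> `` {fcm_add (fcm_add a b) c}"
    using abc x y z \<theta> by (intro om_mult_app om_mult_rep om_mult_Omega)
  moreover have "om_mult n x (om_mult n y z) \<theta> = \<theta> `` {fcm_add a (fcm_add b c)}"
    using abc x y z \<theta> by (intro om_mult_app om_mult_rep om_mult_Omega)
  ultimately show "om_mult n (om_mult n x y) z \<theta> = om_mult n x (om_mult n y z) \<theta>"
    by (simp add: fcm_add_assoc)
qed (use x y z in auto)

lemma om_of_add:
  assumes a: "a \<in> FCM n" and b: "b \<in> FCM n"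
  shows "om_mult n (om_of n a) (om_of n b) = om_of n (fcm_add a b)"
proof (rule Omega_eqI)
  fix \<theta> assume \<theta>: "\<theta> \<in> Cong n"
  show "om_mult n (om_of n a) (om_of n b) \<theta> = om_of n (fcm_add a b) \<theta>"
    using om_mult_app[OF om_of_Omega[OF a] om_of_Omega[OF b] \<theta> om_of_rep[OF \<theta> a] om_of_rep[OF \<theta> b]] \<theta>
    by simp
qed (use a b in auto)

lemma OmM_simps [simp]:
  "carrier (OmM n) = Omega n" "mult (OmM n) = om_mult n" "one (OmM n) = om_one n"
  by (simp_all add: OmM_def)

lemma monoid_hom_OmM_iff:
  "h \<in> monoid_hom (OmM m) H \<longleftrightarrow> (\<forall>x\<in>Omega m. h x \<in> carrier H) \<and>
     (\<forall>x\<in>Omega m. \<forall>y\<in>Omega m. h (om_mult m x y) = mult H (h x) (h y)) \<and> h (om_one m) = one H"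
  by (auto simp: monoid_hom_def hom_def)

section \<open>The inverse limit topology\<close>

lemma topspace_OmT [simp]: "topspace (OmT n) = Omega n"
proof -
  have "Omega n \<subseteq> topspace (product_topology (\<lambda>\<theta>. discrete_topology (FCM n // \<theta>)) (Cong n))"
    by (auto simp: Omega_def)
  then show ?thesis unfolding OmT_def by (rule topspace_subtopology_subset)
qed

lemma continuous_map_OmT_app:
  "\<theta> \<in> Cong n \<Longrightarrow> continuous_map (OmT n) (discrete_topology (FCM n // \<theta>)) (\<lambda>x. x \<theta>)"
  unfolding OmT_def by (intro continuous_map_from_subtopology continuous_map_product_projection)

lemma openin_OmT_agree:
  assumes \<theta>: "\<theta> \<in> Cong n"
  shows "openin (OmT n) {y \<in> Omega n. P (y \<theta>)}"
proof -
  have "openin (OmT n) {y \<in> topspace (OmT n). y \<theta> \<in> {c \<in> FCM n // \<theta>. P c}}"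
    by (rule openin_continuous_map_preimage[OF continuous_map_OmT_app[OF \<theta>]]) auto
  moreover have "{y \<in> topspace (OmT n). y \<theta> \<in> {c \<in> FCM n // \<theta>. P c}} = {y \<in> Omega n. P (y \<theta>)}"
    using Omega_app[OF _ \<theta>] by auto
  ultimately show ?thesis by simp
qed

lemma closedin_OmT_agree:
  assumes \<theta>: "\<theta> \<in> Cong n"
  shows "closedin (OmT n) {y \<in> Omega n. P (y \<theta>)}"
proof -
  have "topspace (OmT n) - {y \<in> Omega n. P (y \<theta>)} = {y \<in> Omega n. \<not> P (y \<theta>)}" by auto
  then show ?thesis using openin_OmT_agree[OF \<theta>, of "\<lambda>c. \<not> P c"] by (auto simp: closedin_def)
qed

text \<open>A basic open set of the product restricts finitely many coordinates. The congruences are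
  directed downwards, so fixing the class at one fine enough level already stays inside it.\<close>

lemma openin_OmT_iff:
  "openin (OmT n) U \<longleftrightarrow>
     U \<subseteq> Omega n \<and> (\<forall>x\<in>U. \<exists>\<theta>\<in>Cong n. \<forall>y\<in>Omega n. y \<theta> = x \<theta> \<longrightarrow> y \<in> U)" (is "?L \<longleftrightarrow> ?R")
proof
  assume L: ?L
  then have sub: "U \<subseteq> Omega n" using openin_subset by fastforce
  let ?X = "\<lambda>\<theta>. discrete_topology (FCM n // \<theta>)"
  obtain V where V: "openin (product_topology ?X (Cong n)) V" "U = V \<inter> Omega n"
    using L unfolding OmT_def openin_subtopology by blast
  have "\<exists>\<theta>\<in>Cong n. \<forall>y\<in>Omega n. y \<theta> = x \<theta> \<longrightarrow> y \<in> U" if x: "x \<in> U" for x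
  proof -
    have "x \<in> V" and xO: "x \<in> Omega n" using x V by auto
    then obtain W where W: "finite {\<theta> \<in> Cong n. W \<theta> \<noteq> topspace (?X \<theta>)}" "x \<in> Pi\<^sub>E (Cong n) W"
        "Pi\<^sub>E (Cong n) W \<subseteq> V"
      using V(1) unfolding openin_product_topology_alt by meson
    \<comment> \<open>A common refinement of the finitely many coordinates that \<open>W\<close>
      restricts: points that agree there agree at all of them.\<close>
    obtain \<theta> where \<theta>: "\<theta> \<in> Cong n" "\<And>\<theta>'. \<theta>' \<in> Cong n \<Longrightarrow> W \<theta>' \<noteq> topspace (?X \<theta>') \<Longrightarrow> \<theta> \<subseteq> \<theta>'"
      using Cong_directed[OF W(1), of n] by blast
    have "y \<in> U" if y: "y \<in> Omega n" "y \<theta> = x \<theta>" for y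
    proof -
      have "y \<theta>' \<in> W \<theta>'" if \<theta>': "\<theta>' \<in> Cong n" for \<theta>'
      proof (cases "W \<theta>' = topspace (?X \<theta>')")
        case True
        then show ?thesis using Omega_app[OF y(1) \<theta>'] by simp
      next
        case False
        then have "y \<theta>' = x \<theta>'" using Omega_eq_finer[OF y(1) xO \<theta>(1) \<theta>'] \<theta>(2) \<theta>' y(2) by blast
        then show ?thesis using W(2) \<theta>' by (metis PiE_mem)
      qed
      then have "y \<in> Pi\<^sub>E (Cong n) W" using y(1) by (auto simp: Omega_def PiE_def)
      then show ?thesis using W(3) V(2) y(1) by auto
    qed
    then show ?thesis using \<theta>(1) by blast
  qed
  then show ?R using sub by blast
next
  assume R: ?R
  show ?L
    unfolding openin_subopen[of _ U]
  proof
    fix x assume x: "x \<in> U"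
    then obtain \<theta> where \<theta>: "\<theta> \<in> Cong n" "\<forall>y\<in>Omega n. y \<theta> = x \<theta> \<longrightarrow> y \<in> U" using R by blast
    have "openin (OmT n) {y \<in> Omega n. y \<theta> = x \<theta>}" by (rule openin_OmT_agree[OF \<theta>(1)])
    then show "\<exists>T. openin (OmT n) T \<and> x \<in> T \<and> T \<subseteq> U"
      using \<theta>(2) x R by (intro exI[of _ "{y \<in> Omega n. y \<theta> = x \<theta>}"]) blast
  qed
qed

lemma OmT_neighbourhood:
  assumes "openin (OmT n) U" "x \<in> U"
  obtains \<theta> where "\<theta> \<in> Cong n" "\<forall>y\<in>Omega n. y \<theta> = x \<theta> \<longrightarrow> y \<in> U"
proof -
  have "\<exists>\<theta>\<in>Cong n. \<forall>y\<in>Omega n. y \<theta> = x \<theta> \<longrightarrow> y \<in> U"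
    using assms(1)[unfolded openin_OmT_iff, THEN conjunct2, THEN bspec, OF assms(2)] .
  then show thesis
    by (elim bexE) (rule that)
qed

lemma openin_OmTI:
  assumes "U \<subseteq> Omega n"
    and "\<And>x. x \<in> U \<Longrightarrow> \<exists>\<theta>\<in>Cong n. \<forall>y\<in>Omega n. y \<theta> = x \<theta> \<longrightarrow> y \<in> U"
  shows "openin (OmT n) U"
  unfolding openin_OmT_iff using assms by simp

lemma Hausdorff_OmT: "Hausdorff_space (OmT n)"
  unfolding OmT_def
  by (intro Hausdorff_space_subtopology) (simp add: Hausdorff_space_product_topology)

text \<open>By the Tychonoff theorem the product of the finite factors is compact. Each coherence
  condition involves only two discrete coordinates, so it is closed, and \<open>Omega n\<close> is
  an intersection of such conditions.\<close>

lemma compact_OmT: "compact_space (OmT n)"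
proof -
  let ?X = "\<lambda>\<theta>. discrete_topology (FCM n // \<theta>)"
  let ?P = "product_topology ?X (Cong n)"
  have "compact_space ?P"
    by (simp add: compact_space_product_topology compact_space_discrete_topology Cong_finite)
  moreover have "closedin ?P (Omega n)"
  proof -
    have cl: "closedin ?P {x \<in> topspace ?P. x \<theta> \<subseteq> x \<theta>'}" if \<theta>: "\<theta> \<in> Cong n" "\<theta>' \<in> Cong n" for \<theta> \<theta>'
    proof -
      have "continuous_map ?P (prod_topology (?X \<theta>) (?X \<theta>')) (\<lambda>x. (x \<theta>, x \<theta>'))"
        using \<theta> by (intro continuous_map_pairedI continuous_map_product_projection)
      then have "closedin ?P {x \<in> topspace ?P. (x \<theta>, x \<theta>') \<in> {(c, c') \<in> (FCM n // \<theta>) \<times> (FCM n // \<theta>'). c \<subseteq> c'}}"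
        by (rule closedin_continuous_map_preimage)
          (auto simp: prod_topology_discrete_topology[symmetric])
      moreover have "{x \<in> topspace ?P. (x \<theta>, x \<theta>') \<in> {(c, c') \<in> (FCM n // \<theta>) \<times> (FCM n // \<theta>'). c \<subseteq> c'}} =
          {x \<in> topspace ?P. x \<theta> \<subseteq> x \<theta>'}"
        using \<theta> by (auto simp: PiE_def Pi_def)
      ultimately show ?thesis by simp
    qed
    have mem: "x \<in> Omega n \<longleftrightarrow> x \<in> topspace ?P \<and>
        (\<forall>\<theta>\<in>Cong n. \<forall>\<theta>'\<in>Cong n. \<theta> \<subseteq> \<theta>' \<longrightarrow> x \<theta> \<subseteq> x \<theta>')" for x
      by (simp add: Omega_def)
    have "Omega n = (\<Inter>\<theta>\<in>Cong n. \<Inter>\<theta>'\<in>{\<theta>' \<in> Cong n. \<theta> \<subseteq> \<theta>'}. {x \<in> topspace ?P. x \<theta> \<subseteq> x \<theta>'})"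
      (is "_ = ?S")
    proof (rule Set.set_eqI)
      fix x
      show "x \<in> Omega n \<longleftrightarrow> x \<in> ?S"
        \<comment> \<open>\<open>Cong_full\<close> provides an index, without which the intersection
          would not force membership in the product.\<close>
        unfolding mem INT_iff mem_Collect_eq using Cong_full[of n] by blast
    qed
    moreover have "closedin ?P ?S"
      using Cong_full[of n] by (intro closedin_INT cl) auto
    ultimately show ?thesis by simp
  qed
  ultimately show ?thesis
    unfolding OmT_def by (intro compact_space_subtopology closedin_compact_space)
qed

text \<open>Turns topological separation into separation in one finite quotient. Finitely many basic
  neighbourhoods that miss \<open>G\<close> cover the compact set \<open>F\<close>, and a common
  refinement of their levels works for all pairs at once.\<close>

lemma OmT_separate_closed:
  assumes F: "closedin (OmT n) F" and G: "closedin (OmT n) G" and FG: "F \<inter> G = {}"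
  shows "\<exists>\<theta>\<in>Cong n. \<forall>x\<in>F. \<forall>y\<in>G. x \<theta> \<noteq> y \<theta>"
proof -
  have FO: "F \<subseteq> Omega n" and GO: "G \<subseteq> Omega n" using closedin_subset[OF F] closedin_subset[OF G] by auto
  have "openin (OmT n) (Omega n - G)" using G by (auto simp: closedin_def)
  note op = this
  have "\<exists>\<theta>. \<theta> \<in> Cong n \<and> (\<forall>y\<in>Omega n. y \<theta> = x \<theta> \<longrightarrow> y \<notin> G)" if "x \<in> F" for x
  proof -
    have "x \<in> Omega n - G" using that FO FG by blast
    from OmT_neighbourhood[OF op this] obtain \<theta> where
      "\<theta> \<in> Cong n" "\<forall>y\<in>Omega n. y \<theta> = x \<theta> \<longrightarrow> y \<in> Omega n - G" .
    then show ?thesis by (intro exI[of _ \<theta>]) simp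
  qed
  then have "\<exists>t. \<forall>x\<in>F. t x \<in> Cong n \<and> (\<forall>y\<in>Omega n. y (t x) = x (t x) \<longrightarrow> y \<notin> G)"
    by (intro bchoice ballI)
  then obtain t where
    t_def: "\<forall>x\<in>F. t x \<in> Cong n \<and> (\<forall>y\<in>Omega n. y (t x) = x (t x) \<longrightarrow> y \<notin> G)" ..
  have t: "t x \<in> Cong n" "y \<in> Omega n \<Longrightarrow> y (t x) = x (t x) \<Longrightarrow> y \<notin> G" if "x \<in> F" for x y
    using bspec[OF t_def that] by simp_all
  define U where "U x = {y \<in> Omega n. y (t x) = x (t x)}" for x
  have xU: "x \<in> U x" if "x \<in> F" for x using that FO by (auto simp: U_def)
  have "\<exists>\<F>. finite \<F> \<and> \<F> \<subseteq> U ` F \<and> F \<subseteq> \<Union>\<F>"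
  proof (rule compactinD)
    show "compactin (OmT n) F" using F compact_OmT closedin_compact_space by blast
    show "openin (OmT n) V" if V: "V \<in> U ` F" for V
    proof -
      obtain x where "x \<in> F" "V = U x" using V by blast
      then show ?thesis unfolding U_def using openin_OmT_agree[OF t(1)] by simp
    qed
    show "F \<subseteq> \<Union>(U ` F)" using xU by blast
  qed
  then obtain E where E: "finite E" "E \<subseteq> F" "F \<subseteq> (\<Union>x\<in>E. U x)"
    by (metis finite_subset_image)
  have "t ` E \<subseteq> Cong n" using E(2) t(1) by blast
  then obtain \<theta> where \<theta>: "\<theta> \<in> Cong n" "\<forall>\<theta>'\<in>t ` E. \<theta> \<subseteq> \<theta>'"
    using Cong_directed[of "t ` E" n] E(1) by blast
  have "x \<theta> \<noteq> y \<theta>" if x: "x \<in> F" and y: "y \<in> G" for x y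
  proof
    assume eq: "x \<theta> = y \<theta>"
    obtain e where e: "e \<in> E" "x \<in> U e" using E(3) x by blast
    have eF: "e \<in> F" and xO: "x \<in> Omega n" and yO: "y \<in> Omega n" using e E(2) x y FO GO by auto
    have "x (t e) = y (t e)"
      using Omega_eq_finer[OF xO yO \<theta>(1) t(1)[OF eF] _ eq] \<theta>(2) e(1) by simp
    then have "y (t e) = e (t e)" using e(2) by (simp add: U_def)
    then show False using t(2)[OF eF yO] y by simp
  qed
  then show ?thesis using \<theta>(1) by blast
qed

lemma continuous_map_om_mult:
  assumes w: "w \<in> Omega n"
  shows "continuous_map (OmT n) (OmT n) (\<lambda>x. om_mult n x w)"
  unfolding continuous_map_def topspace_OmT
proof (intro conjI allI impI Pi_I)
  fix U assume U: "openin (OmT n) U"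
  show "openin (OmT n) {x \<in> Omega n. om_mult n x w \<in> U}"
  proof (rule openin_OmTI)
    fix x assume "x \<in> {x \<in> Omega n. om_mult n x w \<in> U}"
    then have x: "x \<in> Omega n" "om_mult n x w \<in> U" by auto
    obtain \<theta> where \<theta>: "\<theta> \<in> Cong n"
        "\<forall>y\<in>Omega n. y \<theta> = om_mult n x w \<theta> \<longrightarrow> y \<in> U"
      using OmT_neighbourhood[OF U x(2)] .
    have "om_mult n y w \<in> U" if "y \<in> Omega n" "y \<theta> = x \<theta>" for y
      using \<theta>(2)[rule_format, OF om_mult_Omega[OF that(1) w] om_mult_cong[OF that(1) x(1) w \<theta>(1) that(2)]] .
    then show "\<exists>\<theta>\<in>Cong n. \<forall>y\<in>Omega n. y \<theta> = x \<theta> \<longrightarrow> y \<in> {x \<in> Omega n. om_mult n x w \<in> U}"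
      using \<theta>(1) by (intro bexI[of _ \<theta>]) auto
  qed auto
qed (use w in auto)

text \<open>The multiples of \<open>z\<close> form a compact, hence closed, set. Solvability at
  every finite level puts \<open>z'\<close> into its closure.\<close>

lemma om_dvdI:
  assumes z: "z \<in> Omega n" and z': "z' \<in> Omega n"
    and ex: "\<And>\<theta>. \<theta> \<in> Cong n \<Longrightarrow> \<exists>c\<in>Omega n. om_mult n c z \<theta> = z' \<theta>"
  shows "\<exists>c\<in>Omega n. om_mult n c z = z'"
proof (rule ccontr)
  let ?C = "(\<lambda>c. om_mult n c z) ` Omega n"
  assume "\<not> ?thesis"
  then have no: "z' \<in> Omega n - ?C" using z' by blast
  have "compactin (OmT n) ?C"
    using image_compactin[OF _ continuous_map_om_mult[OF z], of "Omega n"] compact_OmT[of n]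
    by (simp add: compact_space_def)
  then have "closedin (OmT n) ?C" using Hausdorff_OmT compactin_imp_closedin by blast
  then have "openin (OmT n) (Omega n - ?C)" by (auto simp: closedin_def)
  from OmT_neighbourhood[OF this no] obtain \<theta> where \<theta>: "\<theta> \<in> Cong n"
    "\<forall>y\<in>Omega n. y \<theta> = z' \<theta> \<longrightarrow> y \<in> Omega n - ?C" .
  obtain c where c: "c \<in> Omega n" "om_mult n c z \<theta> = z' \<theta>" using ex[OF \<theta>(1)] by blast
  then show False using \<theta>(2)[rule_format, OF om_mult_Omega[OF c(1) z] c(2)] by blast
qed

section \<open>Closed congruences\<close>

text \<open>
  The coordinates in \<open>S\<close> have infinite degree, which shows up as the value \<open>t\<close> modulo \<open>cap_cong n t\<close>;
  the coordinates outside \<open>S\<close> have the finite degree given by \<open>a\<close>.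
\<close>

definition degree_rep :: "nat set \<Rightarrow> fcm \<Rightarrow> nat \<Rightarrow> fcm" where
  "degree_rep S a t = (\<lambda>i. if i \<in> S then t else a i)"

definition degree_piece :: "nat \<Rightarrow> nat set \<Rightarrow> fcm \<Rightarrow> om set" where
  "degree_piece n S a = {x \<in> Omega n. \<forall>t. degree_rep S a t \<in> x (cap_cong n t)}"

lemma degree_piece_closed: "closedin (OmT n) (degree_piece n S a)"
proof -
  have "degree_piece n S a = (\<Inter>t. {x \<in> Omega n. degree_rep S a t \<in> x (cap_cong n t)})"
    by (auto simp: degree_piece_def)
  then show ?thesis
    by (simp add: closedin_OmT_agree[OF cap_cong_Cong] closedin_INT)
qed

text \<open>A coordinate has infinite degree if all representatives modulo every truncation reach
  the bound. Otherwise some truncation shows a value strictly below its bound, and this value is the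
  exact degree.\<close>

lemma degree_piece_cover:
  assumes x: "x \<in> Omega n"
  shows "\<exists>S a. S \<subseteq> {..<n} \<and> a \<in> FCM n \<and> x \<in> degree_piece n S a"
proof -
  define S where "S = {i. i < n \<and> (\<forall>t. \<forall>b\<in>x (cap_cong n t). b i \<ge> t)}"
  have "\<exists>k t b. i < n \<and> i \<notin> S \<longrightarrow> b \<in> x (cap_cong n t) \<and> b i = k \<and> k < t" for i
    by (auto simp: S_def not_le)
  then have "\<exists>k. \<forall>i. \<exists>t b. i < n \<and> i \<notin> S \<longrightarrow> b \<in> x (cap_cong n t) \<and> b i = k i \<and> k i < t"
    by (intro choice allI)
  then obtain k where k: "\<forall>i. \<exists>t b. i < n \<and> i \<notin> S \<longrightarrow> b \<in> x (cap_cong n t) \<and> b i = k i \<and> k i < t" ..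
  define a where "a = (\<lambda>i. if i < n then k i else 0)"
  have "degree_rep S a t \<in> x (cap_cong n t)" for t
  proof -
    obtain c where c: "c \<in> FCM n" "c \<in> x (cap_cong n t)" using Omega_rep[OF x cap_cong_Cong] .
    have "min (c i) t = min (degree_rep S a t i) t" for i
    proof (cases "i < n \<and> i \<notin> S")
      case True
      then obtain s b where b: "b \<in> x (cap_cong n s)" "b i = k i" "k i < s" using k by blast
      \<comment> \<open>\<open>e\<close> links the bound \<open>s\<close>, at which the finite
        degree of coordinate \<open>i\<close> is visible, to the given bound \<open>t\<close>: since
        \<open>k i < s\<close>, agreement modulo \<open>s\<close> forces
        \<open>e i = k i\<close>.\<close>
      obtain e where e: "e \<in> x (cap_cong n t)" "e \<in> x (cap_cong n s)"
        using Omega_rep2[OF x cap_cong_Cong cap_cong_Cong] .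
      have "(b, e) \<in> cap_cong n s" "(c, e) \<in> cap_cong n t"
        using Omega_rel[OF x cap_cong_Cong b(1)] Omega_rel[OF x cap_cong_Cong c(2)] e by auto
      then have "min (b i) s = min (e i) s" "min (c i) t = min (e i) t"
        by (auto simp: cap_cong_iff)
      then show ?thesis using b True by (simp add: degree_rep_def a_def min_def split: if_splits)
    next
      case False
      show ?thesis
      proof (cases "i \<in> S")
        case True
        then have "t \<le> c i" using c(2) by (simp add: S_def)
        then show ?thesis using True by (simp add: degree_rep_def)
      next
        case nS: False
        then have "\<not> i < n" using False by blast
        then show ?thesis using nS c(1) by (simp add: degree_rep_def a_def FCM_def)
      qed
    qed
    moreover have "degree_rep S a t \<in> FCM n" by (auto simp: degree_rep_def a_def FCM_def S_def)
    ultimately have "(c, degree_rep S a t) \<in> cap_cong n t" using c by (simp add: cap_cong_iff)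
    then show ?thesis using Omega_rel[OF x cap_cong_Cong c(2)] by blast
  qed
  then have "x \<in> degree_piece n S a" using x by (simp add: degree_piece_def)
  moreover have "S \<subseteq> {..<n}" "a \<in> FCM n" by (auto simp: S_def a_def FCM_def)
  ultimately show ?thesis by blast
qed

lemma countable_FCM: "countable (FCM n)"
proof (rule countableI')
  show "inj_on (\<lambda>a. map a [0..<n]) (FCM n)"
  proof (rule inj_onI)
    fix a b assume ab: "a \<in> FCM n" "b \<in> FCM n" and "map a [0..<n] = map b [0..<n]"
    then have "\<forall>i<n. a i = b i" by auto
    then show "a = b" using ab by (intro ext) (metis (mono_tags, lifting) FCM_def mem_Collect_eq not_le)
  qed
qed

text \<open>A finite degree can be any natural number, so the pieces are infinite in number for
  positive \<open>n\<close>. They are indexed by a finite set of subsets and a countable set of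
  exponent vectors, so one sequence runs through them all, as the sum argument requires.\<close>

lemma degree_pieces_enumeration:
  "\<exists>A :: nat \<Rightarrow> om set. Omega n \<subseteq> (\<Union>k. A k) \<and> (\<forall>k. \<exists>S a. A k = degree_piece n S a)"
proof -
  let ?\<A> = "(\<lambda>(S, a). degree_piece n S a) ` (Pow {..<n} \<times> FCM n)"
  have "countable ?\<A>"
    using countable_FCM by (intro countable_image countable_SIGMA) (auto intro: countable_finite)
  moreover have "?\<A> \<noteq> {}" using FCM_zero[of n] by blast
  ultimately have r: "range (from_nat_into ?\<A>) = ?\<A>" by (simp add: range_from_nat_into)
  have "from_nat_into ?\<A> k \<in> ?\<A>" for k using r by blast
  then have "\<exists>S a. from_nat_into ?\<A> k = degree_piece n S a" for k by force
  moreover have "Omega n \<subseteq> \<Union>?\<A>" using degree_piece_cover by fastforce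
  then have "Omega n \<subseteq> (\<Union>k. from_nat_into ?\<A> k)" unfolding r .
  ultimately show ?thesis by blast
qed

lemma degree_piece_cap_eq:
  assumes "x \<in> degree_piece n S a" "y \<in> degree_piece n S a"
  shows "x (cap_cong n t) = y (cap_cong n t)"
proof -
  have "x \<in> Omega n" "y \<in> Omega n" "degree_rep S a t \<in> x (cap_cong n t)" "degree_rep S a t \<in> y (cap_cong n t)"
    using assms by (auto simp: degree_piece_def)
  then show ?thesis using Omega_eq_iff[OF _ _ cap_cong_Cong] by blast
qed

text \<open>Points of one piece have the same class modulo every truncation. At level \<theta> the
  truncation at its threshold therefore makes the equation solvable, and \<open>om_dvdI\<close>
  yields an exact solution.\<close>

lemma degree_piece_dvd:
  assumes z: "z \<in> degree_piece n S a" and z': "z' \<in> degree_piece n S a"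
  shows "\<exists>c\<in>Omega n. om_mult n c z = z'"
proof (rule om_dvdI)
  show zO: "z \<in> Omega n" and zO': "z' \<in> Omega n" using z z' by (auto simp: degree_piece_def)
  fix \<theta> assume \<theta>: "\<theta> \<in> Cong n"
  obtain t where t: "\<forall>a b. (a, b) \<in> cap_cong n t \<longrightarrow> (\<exists>c\<in>FCM n. (fcm_add c a, b) \<in> \<theta>)"
    using cap_cong_imp_solvable[OF \<theta>] by blast
  obtain p where p: "p \<in> z \<theta>" "p \<in> z (cap_cong n t)" using Omega_rep2[OF zO \<theta> cap_cong_Cong] .
  obtain q where q: "q \<in> z' \<theta>" "q \<in> z' (cap_cong n t)" using Omega_rep2[OF zO' \<theta> cap_cong_Cong] .
  have "(p, q) \<in> cap_cong n t"
    using Omega_rel[OF zO cap_cong_Cong p(2)] q(2) degree_piece_cap_eq[OF z z'] by blast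
  then obtain c where c: "c \<in> FCM n" "(fcm_add c p, q) \<in> \<theta>" using t by blast
  have "om_mult n (om_of n c) z \<theta> = \<theta> `` {fcm_add c p}"
    using om_mult_app[OF om_of_Omega[OF c(1)] zO \<theta> om_of_rep[OF \<theta> c(1)] p(1)] .
  also have "\<dots> = \<theta> `` {q}" using equiv_class_eq[OF Cong_equiv[OF \<theta>] c(2)] .
  also have "\<dots> = z' \<theta>" using Omega_class[OF zO' \<theta> q(1)] by simp
  finally show "\<exists>c\<in>Omega n. om_mult n c z \<theta> = z' \<theta>" using om_of_Omega[OF c(1)] by blast
qed

text \<open>Membership in a piece depends only on the classes modulo the truncations. These agree
  for \<open>w\<close> and \<open>z\<close>, hence also after multiplication by
  \<open>c\<close>.\<close>

lemma degree_piece_mult: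
  assumes c: "c \<in> Omega n" and z: "z \<in> degree_piece n S a" "om_mult n c z \<in> degree_piece n S a"
    and w: "w \<in> degree_piece n S a"
  shows "om_mult n c w \<in> degree_piece n S a"
proof -
  have zO: "z \<in> Omega n" and wO: "w \<in> Omega n" using z w by (auto simp: degree_piece_def)
  have "om_mult n c w (cap_cong n t) = om_mult n c z (cap_cong n t)" for t
    using om_mult_cong[OF wO zO c cap_cong_Cong degree_piece_cap_eq[OF w z(1)]]
      om_mult_commute[OF c wO] om_mult_commute[OF c zO] by simp
  then show ?thesis using z(2) om_mult_Omega[OF c wO] by (simp add: degree_piece_def)
qed

section \<open>Separation by clopen saturated sets and by congruences of finite index\<close>

definition Omega_congruence :: "nat \<Rightarrow> (om \<times> om) set \<Rightarrow> bool" where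
  "Omega_congruence n R \<longleftrightarrow> equiv (Omega n) R \<and>
     (\<forall>x y w. (x, y) \<in> R \<longrightarrow> w \<in> Omega n \<longrightarrow> (om_mult n x w, om_mult n y w) \<in> R)"

text \<open>
  The set \<open>P\<close> consists of the points of the piece that agree modulo \<open>\<theta>\<close> with a point of \<open>F\<close>. It is
  saturated because multiplication moves such a pair of points along \<open>R\<close>: if \<open>z R z'\<close>, \<open>c z = z'\<close>
  and \<open>d z = w\<close>, then \<open>w R d z' = c w\<close>.
\<close>

lemma degree_piece_separation:
  assumes R: "Omega_congruence n R" and FG: "saturated_disjoint (OmT n) R (F, G)"
    and A: "A = degree_piece n S a"
  shows "\<exists>P Q. closedin (OmT n) P \<and> closedin (OmT n) Q \<and> A \<subseteq> P \<union> Q \<and> P \<inter> G = {} \<and>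
    Q \<inter> F = {} \<and> R `` P \<inter> Q = {}"
proof -
  have F: "closedin (OmT n) F" and FR: "R `` F \<subseteq> F" and G: "closedin (OmT n) G" and disj: "F \<inter> G = {}"
    using FG by (auto simp: saturated_disjoint_def saturated_closed_def)
  have R_mult: "(om_mult n x w, om_mult n y w) \<in> R" if "(x, y) \<in> R" "w \<in> Omega n" for x y w
    using R that unfolding Omega_congruence_def by blast
  have Acl: "closedin (OmT n) A" using degree_piece_closed A by simp
  have AO: "A \<subseteq> Omega n" using A by (auto simp: degree_piece_def)
  have "A \<inter> F \<inter> (A \<inter> G) = {}" using disj by blast
  then obtain \<theta> where \<theta>: "\<theta> \<in> Cong n" "\<forall>x\<in>A \<inter> F. \<forall>y\<in>A \<inter> G. x \<theta> \<noteq> y \<theta>"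
    using OmT_separate_closed[OF closedin_Int[OF Acl F] closedin_Int[OF Acl G]] by meson
  \<comment> \<open>Belonging to \<open>C\<close> at level \<theta> is a clopen condition, so it
    cuts the closed piece into two closed parts.\<close>
  define C where "C = (\<lambda>w. w \<theta>) ` (A \<inter> F)"
  define P where "P = A \<inter> {z \<in> Omega n. z \<theta> \<in> C}"
  define Q where "Q = A \<inter> {z \<in> Omega n. z \<theta> \<notin> C}"
  have "closedin (OmT n) P" "closedin (OmT n) Q"
    unfolding P_def Q_def by (intro closedin_Int Acl closedin_OmT_agree[OF \<theta>(1)])+
  moreover have "A \<subseteq> P \<union> Q" unfolding P_def Q_def using AO by auto
  moreover have "P \<inter> G = {}"
  proof -
    have "z \<theta> \<notin> C" if "z \<in> A \<inter> G" for z
      using \<theta>(2) that unfolding C_def by (metis imageE)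
    then show ?thesis unfolding P_def by auto
  qed
  moreover have "Q \<inter> F = {}" unfolding Q_def C_def by auto
  moreover have "z' \<notin> Q" if zz': "(z, z') \<in> R" and z: "z \<in> P" for z z'
  proof
    assume "z' \<in> Q"
    then have z'A: "z' \<in> A" and z'C: "z' \<theta> \<notin> C" unfolding Q_def by auto
    have zA: "z \<in> A" and "z \<theta> \<in> C" using z unfolding P_def by auto
    then obtain w where w: "w \<in> A" "w \<in> F" "w \<theta> = z \<theta>" unfolding C_def by auto
    have O: "z \<in> Omega n" "z' \<in> Omega n" "w \<in> Omega n" using zA z'A w AO by auto
    obtain c where c: "c \<in> Omega n" "om_mult n c z = z'"
      using degree_piece_dvd zA z'A unfolding A by blast
    obtain d where d: "d \<in> Omega n" "om_mult n d z = w"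
      using degree_piece_dvd zA w(1) unfolding A by blast
    have "om_mult n z' d = om_mult n c w"
      using c d O om_mult_assoc om_mult_commute by metis
    moreover have "om_mult n z d = w" using d O om_mult_commute by metis
    ultimately have "(w, om_mult n c w) \<in> R" using R_mult[OF zz' d(1)] by simp
    then have "om_mult n c w \<in> F" using FR w(2) by blast
    moreover have "om_mult n c w \<in> A"
      using degree_piece_mult[OF c(1)] zA z'A w(1) c(2) unfolding A by blast
    ultimately have "om_mult n c w \<theta> \<in> C" unfolding C_def by blast
    \<comment> \<open>Multiplication by \<open>c\<close> preserves the agreement of \<open>w\<close>
      and \<open>z\<close> at level \<theta>. So \<open>z'\<close> agrees there with
      \<open>c w\<close>, a point of \<open>F\<close> in the piece, which membership in
      \<open>Q\<close> forbids.\<close>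
    moreover have "om_mult n c w \<theta> = z' \<theta>"
      using om_mult_cong[OF O(3) O(1) c(1) \<theta>(1) w(3)] om_mult_commute[OF c(1)] O c(2) by simp
    ultimately show False using z'C by simp
  qed
  then have "R `` P \<inter> Q = {}" by blast
  ultimately show ?thesis by blast
qed

lemma Omega_congruence_clopen:
  assumes R: "Omega_congruence n R" "closedin (prod_topology (OmT n) (OmT n)) R"
    and uv: "u \<in> Omega n" "v \<in> Omega n" "(u, v) \<notin> R"
  shows "\<exists>K. openin (OmT n) K \<and> closedin (OmT n) K \<and> R `` K \<subseteq> K \<and> u \<in> K \<and> v \<notin> K"
proof -
  have eq: "equiv (topspace (OmT n)) R" using R(1) by (simp add: Omega_congruence_def)
  have R_refl: "(x, x) \<in> R" if "x \<in> Omega n" for x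
    using eq that by (auto simp: equiv_def refl_on_def)
  have R_sym: "(y, x) \<in> R" if "(x, y) \<in> R" for x y
    using eq that by (auto simp: equiv_def sym_def)
  have R_trans: "(x, z) \<in> R" if "(x, y) \<in> R" "(y, z) \<in> R" for x y z
    using eq that by (meson equivE transD)
  have single: "closedin (OmT n) {x}" if "x \<in> Omega n" for x
    using that Hausdorff_OmT by (simp add: closedin_Hausdorff_sing_eq)
  have sat: "saturated_closed (OmT n) R (R `` {x})" if "x \<in> Omega n" for x
    unfolding saturated_closed_def
    using closedin_Image[OF compact_OmT R(2) single[OF that]] R_trans by blast
  have "False" if "(u, z) \<in> R" "(v, z) \<in> R" for z
    using R_trans[OF that(1) R_sym[OF that(2)]] uv(3) by blast
  then have disj: "saturated_disjoint (OmT n) R (R `` {u}, R `` {v})"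
    using sat uv by (auto simp: saturated_disjoint_def)
  obtain A :: "nat \<Rightarrow> om set" where A: "Omega n \<subseteq> (\<Union>k. A k)" "\<forall>k. \<exists>S a. A k = degree_piece n S a"
    using degree_pieces_enumeration by blast
  have "\<exists>K. openin (OmT n) K \<and> closedin (OmT n) K \<and> R `` K \<subseteq> K \<and> R `` {u} \<subseteq> K \<and> K \<inter> R `` {v} = {}"
  proof (rule clopen_saturated_separation[OF compact_OmT Hausdorff_OmT eq R(2) _ _ disj])
    show "topspace (OmT n) \<subseteq> (\<Union>k. A k)" using A(1) by simp
    fix k F G assume FG: "saturated_disjoint (OmT n) R (F, G)"
    obtain S a where "A k = degree_piece n S a" using A(2) by blast
    then show "\<exists>P Q. closedin (OmT n) P \<and> closedin (OmT n) Q \<and> A k \<subseteq> P \<union> Q \<and> P \<inter> G = {} \<and>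
        Q \<inter> F = {} \<and> R `` P \<inter> Q = {}"
      by (rule degree_piece_separation[OF R(1) FG])
  qed
  then obtain K where K: "openin (OmT n) K" "closedin (OmT n) K" "R `` K \<subseteq> K" "R `` {u} \<subseteq> K" "K \<inter> R `` {v} = {}"
    by blast
  have "u \<in> K" "v \<notin> K" using K(4,5) R_refl uv(1,2) by blast+
  then show ?thesis using K by blast
qed

text \<open>A clopen set \<open>K\<close> is decided at one finite level \<theta>. The congruence
  \<sigma> that compares elements by their translates in \<open>K\<close> is coarser than \<theta>,
  so its index is finite. Compatibility of \<open>R\<close> and saturation of \<open>K\<close> make
  related points equal modulo \<sigma>.\<close>

lemma Omega_congruence_Cong_separation:
  assumes R: "Omega_congruence n R" "closedin (prod_topology (OmT n) (OmT n)) R"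
    and uv: "u \<in> Omega n" "v \<in> Omega n" "(u, v) \<notin> R"
  shows "\<exists>\<sigma>\<in>Cong n. (\<forall>x y. (x, y) \<in> R \<longrightarrow> x \<sigma> = y \<sigma>) \<and> u \<sigma> \<noteq> v \<sigma>"
proof -
  obtain K where K: "openin (OmT n) K" "closedin (OmT n) K" "R `` K \<subseteq> K" "u \<in> K" "v \<notin> K"
    using Omega_congruence_clopen[OF R uv] by blast
  have R_sub: "x \<in> Omega n" "y \<in> Omega n" if "(x, y) \<in> R" for x y
    using R(1) that unfolding Omega_congruence_def equiv_def by auto
  have R_sym: "(y, x) \<in> R" if "(x, y) \<in> R" for x y
    using R(1) that by (auto simp: Omega_congruence_def equiv_def sym_def)
  have R_mult: "(om_mult n x w, om_mult n y w) \<in> R" if "(x, y) \<in> R" "w \<in> Omega n" for x y w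
    using R(1) that unfolding Omega_congruence_def by blast
  have "closedin (OmT n) (Omega n - K)" using openin_closedin_eq[of "OmT n" K] K(1) by simp
  then obtain \<theta> where \<theta>: "\<theta> \<in> Cong n" "\<forall>x\<in>K. \<forall>y\<in>Omega n - K. x \<theta> \<noteq> y \<theta>"
    using OmT_separate_closed[OF K(2), of "Omega n - K"] by auto
  have K_iff: "x \<in> K \<longleftrightarrow> y \<in> K" if "x \<in> Omega n" "y \<in> Omega n" "x \<theta> = y \<theta>" for x y
    using \<theta>(2) that by (metis DiffI)
  \<comment> \<open>the syntactic congruence of \<open>K\<close>\<close>
  define \<sigma> where "\<sigma> = {(a, b). a \<in> FCM n \<and> b \<in> FCM n \<and>
    (\<forall>c\<in>FCM n. om_of n (fcm_add a c) \<in> K \<longleftrightarrow> om_of n (fcm_add b c) \<in> K)}"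
  have "\<theta> \<subseteq> \<sigma>"
  proof (rule subrelI)
    fix a b assume ab: "(a, b) \<in> \<theta>"
    have F: "a \<in> FCM n" "b \<in> FCM n" using Cong_sub[OF \<theta>(1) ab] by auto
    have "om_of n (fcm_add a c) \<in> K \<longleftrightarrow> om_of n (fcm_add b c) \<in> K" if c: "c \<in> FCM n" for c
    proof (rule K_iff)
      have "(fcm_add a c, fcm_add b c) \<in> \<theta>" using Cong_add[OF \<theta>(1) ab Cong_refl[OF \<theta>(1) c]] .
      then show "om_of n (fcm_add a c) \<theta> = om_of n (fcm_add b c) \<theta>"
        using equiv_class_eq[OF Cong_equiv[OF \<theta>(1)]] \<theta>(1) by simp
    qed (use F c in auto)
    then show "(a, b) \<in> \<sigma>" using F by (simp add: \<sigma>_def)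
  qed
  moreover have "equiv (FCM n) \<sigma>"
    by (auto simp: \<sigma>_def equiv_def refl_on_def sym_def trans_def)
  moreover have "(fcm_add a c, fcm_add b d) \<in> \<sigma>" if "(a, b) \<in> \<sigma>" "(c, d) \<in> \<sigma>" for a b c d
  proof -
    have F: "a \<in> FCM n" "b \<in> FCM n" "c \<in> FCM n" "d \<in> FCM n" using that by (auto simp: \<sigma>_def)
    have "om_of n (fcm_add (fcm_add a c) e) \<in> K \<longleftrightarrow> om_of n (fcm_add (fcm_add b d) e) \<in> K"
      if e: "e \<in> FCM n" for e
    proof -
      have "om_of n (fcm_add a (fcm_add c e)) \<in> K \<longleftrightarrow> om_of n (fcm_add b (fcm_add c e)) \<in> K"
        using \<open>(a, b) \<in> \<sigma>\<close> F e by (simp add: \<sigma>_def)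
      moreover have "om_of n (fcm_add c (fcm_add b e)) \<in> K \<longleftrightarrow> om_of n (fcm_add d (fcm_add b e)) \<in> K"
        using \<open>(c, d) \<in> \<sigma>\<close> F e by (simp add: \<sigma>_def)
      moreover have "fcm_add b (fcm_add c e) = fcm_add c (fcm_add b e)"
        "fcm_add d (fcm_add b e) = fcm_add (fcm_add b d) e"
        by (simp_all add: fcm_add_def algebra_simps)
      ultimately show ?thesis by (simp add: fcm_add_assoc)
    qed
    then show ?thesis using F by (simp add: \<sigma>_def)
  qed
  ultimately have \<sigma>: "\<sigma> \<in> Cong n" using Cong_coarser[OF \<theta>(1)] by blast
  have "x \<sigma> = y \<sigma>" if xy: "(x, y) \<in> R" for x y
  proof -
    have O: "x \<in> Omega n" "y \<in> Omega n" using R_sub xy by auto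
    obtain a where a: "a \<in> FCM n" "a \<in> x \<theta>" using Omega_rep[OF O(1) \<theta>(1)] .
    obtain b where b: "b \<in> FCM n" "b \<in> y \<theta>" using Omega_rep[OF O(2) \<theta>(1)] .
    \<comment> \<open>Membership in \<open>K\<close> depends only on the class modulo \<theta>, so a
      profinite point may be replaced by a representative from the free monoid.\<close>
    have shift: "om_of n (fcm_add a c) \<in> K \<longleftrightarrow> om_mult n x (om_of n c) \<in> K"
      if "x \<in> Omega n" "a \<in> FCM n" "a \<in> x \<theta>" "c \<in> FCM n" for x a c
    proof (rule K_iff)
      show "om_of n (fcm_add a c) \<theta> = om_mult n x (om_of n c) \<theta>"
        using om_mult_app[OF that(1) om_of_Omega[OF that(4)] \<theta>(1) that(3) om_of_rep[OF \<theta>(1) that(4)]] \<theta>(1)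
        by simp
    qed (use that in auto)
    have "om_of n (fcm_add a c) \<in> K \<longleftrightarrow> om_of n (fcm_add b c) \<in> K" if c: "c \<in> FCM n" for c
    proof -
      have "(om_mult n x (om_of n c), om_mult n y (om_of n c)) \<in> R" using R_mult[OF xy] c by simp
      then have "om_mult n x (om_of n c) \<in> K \<longleftrightarrow> om_mult n y (om_of n c) \<in> K"
        using K(3) R_sym by blast
      then show ?thesis using shift[OF O(1) a c] shift[OF O(2) b c] by simp
    qed
    then have "(a, b) \<in> \<sigma>" using a b by (simp add: \<sigma>_def)
    moreover have "a \<in> x \<sigma>" "b \<in> y \<sigma>"
      using a b Omega_mono[OF O(1) \<theta>(1) \<sigma> \<open>\<theta> \<subseteq> \<sigma>\<close>] Omega_mono[OF O(2) \<theta>(1) \<sigma> \<open>\<theta> \<subseteq> \<sigma>\<close>] by auto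
    ultimately show ?thesis
      using Omega_rel[OF O(1) \<sigma>] Omega_eq_iff[OF O(2) O(1) \<sigma>] by metis
  qed
  moreover have "u \<sigma> \<noteq> v \<sigma>"
  proof
    assume eq: "u \<sigma> = v \<sigma>"
    obtain a where a: "a \<in> FCM n" "a \<in> u \<theta>" using Omega_rep[OF uv(1) \<theta>(1)] .
    obtain b where b: "b \<in> FCM n" "b \<in> v \<theta>" using Omega_rep[OF uv(2) \<theta>(1)] .
    have "a \<in> u \<sigma>" "b \<in> u \<sigma>"
      using a b eq Omega_mono[OF uv(1) \<theta>(1) \<sigma> \<open>\<theta> \<subseteq> \<sigma>\<close>] Omega_mono[OF uv(2) \<theta>(1) \<sigma> \<open>\<theta> \<subseteq> \<sigma>\<close>] by auto
    then have "(a, b) \<in> \<sigma>" using Omega_rel[OF uv(1) \<sigma>] by blast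
    \<comment> \<open>The translation by zero tests membership in \<open>K\<close> itself, and
      \<open>u\<close> and \<open>v\<close> differ there.\<close>
    then have "om_of n (fcm_add a fcm_zero) \<in> K \<longleftrightarrow> om_of n (fcm_add b fcm_zero) \<in> K"
      using FCM_zero[of n] by (simp only: \<sigma>_def mem_Collect_eq case_prod_conv)
    moreover have "om_of n a \<in> K \<longleftrightarrow> u \<in> K"
      using K_iff[OF om_of_Omega[OF a(1)] uv(1)] Omega_class[OF uv(1) \<theta>(1) a(2)] \<theta>(1) by simp
    moreover have "om_of n b \<in> K \<longleftrightarrow> v \<in> K"
      using K_iff[OF om_of_Omega[OF b(1)] uv(2)] Omega_class[OF uv(2) \<theta>(1) b(2)] \<theta>(1) by simp
    ultimately show False using K(4,5) by simp
  qed
  ultimately show ?thesis using \<sigma> by blast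
qed

section \<open>Finite quotients and lifting of homomorphisms\<close>

text \<open>The members of \<open>Com\<close> live on natural numbers, so the quotient is
  transported along an injective numbering of its finitely many classes. The map \<open>g\<close>,
  whose kernel is \<sigma>, stands for the quotient map from here on.\<close>

lemma Cong_quotient_monoid:
  assumes \<sigma>: "\<sigma> \<in> Cong n"
  shows "\<exists>T g. T \<in> Com \<and> carrier T = g ` FCM n \<and>
    (\<forall>a\<in>FCM n. \<forall>b\<in>FCM n. g (fcm_add a b) = g a \<otimes>\<^bsub>T\<^esub> g b) \<and> g fcm_zero = \<one>\<^bsub>T\<^esub> \<and>
    (\<forall>a\<in>FCM n. \<forall>b\<in>FCM n. g a = g b \<longleftrightarrow> (a, b) \<in> \<sigma>)"
proof -
  obtain h :: "fcm set \<Rightarrow> nat" where h: "inj_on h (FCM n // \<sigma>)"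
    using finite_imp_inj_to_nat_seg[OF Cong_finite[OF \<sigma>]] by blast
  define g where "g a = h (\<sigma> `` {a})" for a
  have g_eq: "g a = g b \<longleftrightarrow> (a, b) \<in> \<sigma>" if "a \<in> FCM n" "b \<in> FCM n" for a b
    using inj_on_eq_iff[OF h quotientI[OF that(1)] quotientI[OF that(2)]] Cong_class_eq[OF \<sigma> that]
    by (simp add: g_def)
  define r where "r k = (SOME a. a \<in> FCM n \<and> g a = k)" for k
  have r: "r (g a) \<in> FCM n" "g (r (g a)) = g a" if "a \<in> FCM n" for a
    using someI[of "\<lambda>b. b \<in> FCM n \<and> g b = g a" a] that by (auto simp: r_def)
  define T :: "nat monoid" where
    "T = \<lparr>carrier = g ` FCM n, mult = (\<lambda>i j. g (fcm_add (r i) (r j))), one = g fcm_zero\<rparr>"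
  have T_mult: "g a \<otimes>\<^bsub>T\<^esub> g b = g (fcm_add a b)" if "a \<in> FCM n" "b \<in> FCM n" for a b
  proof -
    have "(r (g a), a) \<in> \<sigma>" "(r (g b), b) \<in> \<sigma>" using r[OF that(1)] r[OF that(2)] that g_eq by auto
    then have "(fcm_add (r (g a)) (r (g b)), fcm_add a b) \<in> \<sigma>" by (rule Cong_add[OF \<sigma>])
    then show ?thesis using that r by (simp add: T_def g_eq)
  qed
  have T_simps: "carrier T = g ` FCM n" "\<one>\<^bsub>T\<^esub> = g fcm_zero" by (simp_all add: T_def)
  have "comm_monoid T"
  proof (rule comm_monoidI)
    show "x \<otimes>\<^bsub>T\<^esub> y \<in> carrier T" if "x \<in> carrier T" "y \<in> carrier T" for x y
      using that by (auto simp: T_simps T_mult)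
    show "\<one>\<^bsub>T\<^esub> \<in> carrier T" by (auto simp: T_simps)
    show "x \<otimes>\<^bsub>T\<^esub> y \<otimes>\<^bsub>T\<^esub> z = x \<otimes>\<^bsub>T\<^esub> (y \<otimes>\<^bsub>T\<^esub> z)"
      if "x \<in> carrier T" "y \<in> carrier T" "z \<in> carrier T" for x y z
      using that by (auto simp: T_simps T_mult fcm_add_assoc)
    show "\<one>\<^bsub>T\<^esub> \<otimes>\<^bsub>T\<^esub> x = x" if "x \<in> carrier T" for x
      using that by (auto simp: T_simps T_mult)
    show "x \<otimes>\<^bsub>T\<^esub> y = y \<otimes>\<^bsub>T\<^esub> x" if "x \<in> carrier T" "y \<in> carrier T" for x y
      using that by (auto simp: T_simps T_mult fcm_add_commute)
  qed
  moreover have "carrier T \<subseteq> h ` (FCM n // \<sigma>)"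
    unfolding T_simps g_def by (auto intro: quotientI)
  then have "finite (carrier T)" using Cong_finite[OF \<sigma>] finite_subset by blast
  ultimately have "T \<in> Com" by (simp add: Com_def)
  then show ?thesis
    using T_simps T_mult g_eq by (intro exI[of _ T] exI[of _ g]) simp
qed

section \<open>Extending homomorphisms to the completions and lifting along a finite
  quotient\<close>

definition fcm_hom :: "nat \<Rightarrow> nat \<Rightarrow> (fcm \<Rightarrow> fcm) \<Rightarrow> bool" where
  "fcm_hom m n f \<longleftrightarrow> (\<forall>a\<in>FCM m. f a \<in> FCM n) \<and> f fcm_zero = fcm_zero \<and>
     (\<forall>a\<in>FCM m. \<forall>b\<in>FCM m. f (fcm_add a b) = fcm_add (f a) (f b))"

definition pullback_cong :: "nat \<Rightarrow> (fcm \<Rightarrow> fcm) \<Rightarrow> (fcm \<times> fcm) set \<Rightarrow> (fcm \<times> fcm) set" where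
  "pullback_cong m f \<theta> = {(a, b). a \<in> FCM m \<and> b \<in> FCM m \<and> (f a, f b) \<in> \<theta>}"

text \<open>The continuous extension of \<open>f\<close> to the completions: its class at \<theta>
  is read off from \<open>x\<close> at the preimage of \<theta>, a congruence of finite
  index.\<close>

definition om_map :: "nat \<Rightarrow> nat \<Rightarrow> (fcm \<Rightarrow> fcm) \<Rightarrow> om \<Rightarrow> om" where
  "om_map m n f x = (\<lambda>\<theta>\<in>Cong n. \<theta> `` {f (SOME a. a \<in> x (pullback_cong m f \<theta>))})"

lemma pullback_cong_Cong:
  assumes f: "fcm_hom m n f" and \<theta>: "\<theta> \<in> Cong n"
  shows "pullback_cong m f \<theta> \<in> Cong m"
proof -
  have fF: "f a \<in> FCM n" if "a \<in> FCM m" for a using f that by (simp add: fcm_hom_def)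
  have "{(a, b). a \<in> FCM m \<and> b \<in> FCM m \<and> \<theta> `` {f a} = \<theta> `` {f b}} \<in> Cong m"
  proof (rule Cong_kernel)
    have "(\<lambda>a. \<theta> `` {f a}) ` FCM m \<subseteq> FCM n // \<theta>" using fF by (auto intro: quotientI)
    then show "finite ((\<lambda>a. \<theta> `` {f a}) ` FCM m)" using Cong_finite[OF \<theta>] finite_subset by blast
    fix a b c assume F: "a \<in> FCM m" "b \<in> FCM m" "c \<in> FCM m" and eq: "\<theta> `` {f a} = \<theta> `` {f b}"
    have "(f a, f b) \<in> \<theta>" using Cong_class_eq[OF \<theta> fF fF] F eq by blast
    then have "(fcm_add (f a) (f c), fcm_add (f b) (f c)) \<in> \<theta>"
      using Cong_add[OF \<theta> _ Cong_refl[OF \<theta> fF]] F by blast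
    then show "\<theta> `` {f (fcm_add a c)} = \<theta> `` {f (fcm_add b c)}"
      using equiv_class_eq[OF Cong_equiv[OF \<theta>]] f F by (simp add: fcm_hom_def)
  qed
  moreover have "{(a, b). a \<in> FCM m \<and> b \<in> FCM m \<and> \<theta> `` {f a} = \<theta> `` {f b}} = pullback_cong m f \<theta>"
    unfolding pullback_cong_def using Cong_class_eq[OF \<theta> fF fF] by blast
  ultimately show ?thesis by simp
qed

lemma om_map_app:
  assumes f: "fcm_hom m n f" and \<theta>: "\<theta> \<in> Cong n" and x: "x \<in> Omega m" and a: "a \<in> x (pullback_cong m f \<theta>)"
  shows "om_map m n f x \<theta> = \<theta> `` {f a}"
proof -
  let ?a = "SOME a. a \<in> x (pullback_cong m f \<theta>)"
  have "?a \<in> x (pullback_cong m f \<theta>)"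
    using someI[of "\<lambda>b. b \<in> x (pullback_cong m f \<theta>)" a] a by simp
  then have "(a, ?a) \<in> pullback_cong m f \<theta>" using Omega_rel[OF x pullback_cong_Cong[OF f \<theta>] a] by blast
  then have "(f a, f ?a) \<in> \<theta>" by (simp add: pullback_cong_def)
  then have "\<theta> `` {f a} = \<theta> `` {f ?a}" by (rule equiv_class_eq[OF Cong_equiv[OF \<theta>]])
  then show ?thesis using \<theta> by (simp add: om_map_def)
qed

lemma om_map_Omega:
  assumes f: "fcm_hom m n f" and x: "x \<in> Omega m"
  shows "om_map m n f x \<in> Omega n"
  unfolding om_map_def
proof (rule OmegaI)
  let ?c = "\<lambda>\<theta>. SOME a. a \<in> x (pullback_cong m f \<theta>)"
  have c: "?c \<theta> \<in> x (pullback_cong m f \<theta>)" if "\<theta> \<in> Cong n" for \<theta>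
    using Omega_rep[OF x pullback_cong_Cong[OF f that]] by (metis someI_ex)
  fix \<theta> assume \<theta>: "\<theta> \<in> Cong n"
  show "f (?c \<theta>) \<in> FCM n"
    using Omega_FCM[OF x pullback_cong_Cong[OF f \<theta>] c[OF \<theta>]] f by (simp add: fcm_hom_def)
  fix \<theta>' assume \<theta>': "\<theta>' \<in> Cong n" "\<theta> \<subseteq> \<theta>'"
  have "pullback_cong m f \<theta> \<subseteq> pullback_cong m f \<theta>'" using \<theta>'(2) by (auto simp: pullback_cong_def)
  then have "?c \<theta> \<in> x (pullback_cong m f \<theta>')"
    using Omega_mono[OF x pullback_cong_Cong[OF f \<theta>] pullback_cong_Cong[OF f \<theta>'(1)]] c[OF \<theta>] by blast
  then have "(?c \<theta>', ?c \<theta>) \<in> pullback_cong m f \<theta>'"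
    using Omega_rel[OF x pullback_cong_Cong[OF f \<theta>'(1)] c[OF \<theta>'(1)]] by blast
  then show "(f (?c \<theta>'), f (?c \<theta>)) \<in> \<theta>'" by (simp add: pullback_cong_def)
qed

lemma om_map_cont_hom:
  assumes f: "fcm_hom m n f"
  shows "om_map m n f \<in> cont_hom m n"
proof -
  have "om_map m n f (om_mult m x y) = om_mult n (om_map m n f x) (om_map m n f y)"
    if x: "x \<in> Omega m" and y: "y \<in> Omega m" for x y
  proof (rule Omega_eqI)
    fix \<theta> assume \<theta>: "\<theta> \<in> Cong n"
    note p = pullback_cong_Cong[OF f \<theta>]
    obtain a where a: "a \<in> FCM m" "a \<in> x (pullback_cong m f \<theta>)" using Omega_rep[OF x p] .
    obtain b where b: "b \<in> FCM m" "b \<in> y (pullback_cong m f \<theta>)" using Omega_rep[OF y p] .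
    have fab: "f a \<in> FCM n" "f b \<in> FCM n" using f a b by (auto simp: fcm_hom_def)
    have "om_map m n f (om_mult m x y) \<theta> = \<theta> `` {f (fcm_add a b)}"
      using om_map_app[OF f \<theta> om_mult_Omega[OF x y] om_mult_rep[OF x y p a(2) b(2)]] .
    also have "\<dots> = \<theta> `` {fcm_add (f a) (f b)}" using f a b by (simp add: fcm_hom_def)
    also have "\<dots> = om_mult n (om_map m n f x) (om_map m n f y) \<theta>"
    proof (rule om_mult_app[symmetric, OF om_map_Omega[OF f x] om_map_Omega[OF f y] \<theta>])
      show "f a \<in> om_map m n f x \<theta>" using om_map_app[OF f \<theta> x a(2)] Cong_refl[OF \<theta> fab(1)] by blast
      show "f b \<in> om_map m n f y \<theta>" using om_map_app[OF f \<theta> y b(2)] Cong_refl[OF \<theta> fab(2)] by blast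
    qed
    finally show "om_map m n f (om_mult m x y) \<theta> = om_mult n (om_map m n f x) (om_map m n f y) \<theta>" .
  qed (use f x y in \<open>auto simp: om_map_Omega\<close>)
  moreover have "om_map m n f (om_one m) = om_one n"
  proof (rule Omega_eqI)
    fix \<theta> assume \<theta>: "\<theta> \<in> Cong n"
    have "fcm_zero \<in> om_one m (pullback_cong m f \<theta>)"
      unfolding om_one_eq by (rule om_of_rep[OF pullback_cong_Cong[OF f \<theta>] FCM_zero])
    from om_map_app[OF f \<theta> om_one_Omega this] show "om_map m n f (om_one m) \<theta> = om_one n \<theta>"
      using f \<theta> by (simp add: fcm_hom_def om_one_eq)
  qed (use f in \<open>auto simp: om_map_Omega\<close>)
  ultimately have "om_map m n f \<in> monoid_hom (OmM m) (OmM n)"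
    using om_map_Omega[OF f] by (simp add: monoid_hom_OmM_iff)
  moreover have "continuous_map (OmT m) (OmT n) (om_map m n f)"
    unfolding continuous_map_def topspace_OmT
  proof (intro conjI allI impI Pi_I)
    fix U assume U: "openin (OmT n) U"
    show "openin (OmT m) {x \<in> Omega m. om_map m n f x \<in> U}"
    proof (rule openin_OmTI)
      fix x assume "x \<in> {x \<in> Omega m. om_map m n f x \<in> U}"
      then have x: "x \<in> Omega m" "om_map m n f x \<in> U" by auto
      obtain \<theta> where \<theta>: "\<theta> \<in> Cong n" "\<forall>y\<in>Omega n. y \<theta> = om_map m n f x \<theta> \<longrightarrow> y \<in> U"
        using OmT_neighbourhood[OF U x(2)] .
      have "om_map m n f y \<in> U" if y: "y \<in> Omega m" "y (pullback_cong m f \<theta>) = x (pullback_cong m f \<theta>)" for y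
      proof -
        have "om_map m n f y \<theta> = om_map m n f x \<theta>" using \<theta>(1) y(2) by (simp add: om_map_def)
        then show ?thesis using \<theta>(2) om_map_Omega[OF f y(1)] by blast
      qed
      then show "\<exists>\<theta>\<in>Cong m. \<forall>y\<in>Omega m. y \<theta> = x \<theta> \<longrightarrow> y \<in> {x \<in> Omega m. om_map m n f x \<in> U}"
        using pullback_cong_Cong[OF f \<theta>(1)] by (intro bexI[of _ "pullback_cong m f \<theta>"]) auto
    qed auto
  qed (use f in \<open>auto simp: om_map_Omega\<close>)
  ultimately show ?thesis by (simp add: cont_hom_def)
qed

lemma FCM_induct [consumes 1, case_names zero gen add]:
  assumes a: "a \<in> FCM m" and zero: "P fcm_zero" and gen: "\<And>i. i < m \<Longrightarrow> P (fcm_gen i 1)"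
    and add: "\<And>a b. a \<in> FCM m \<Longrightarrow> b \<in> FCM m \<Longrightarrow> P a \<Longrightarrow> P b \<Longrightarrow> P (fcm_add a b)"
  shows "P a"
proof -
  have gens: "P (fcm_gen i k)" if i: "i < m" for i k
  proof (induction k)
    case 0
    then show ?case using zero by (simp add: fcm_gen_def fcm_zero_def)
  next
    case (Suc k)
    then show ?case using add[OF _ _ Suc gen[OF i]] i by (simp add: fcm_gen_add)
  qed
  have "P (\<lambda>j. if j < k then a j else 0)" if "k \<le> m" for k
    using that
  proof (induction k)
    case 0
    then show ?case using zero by (simp add: fcm_zero_def)
  next
    case (Suc k)
    have "fcm_add (\<lambda>j. if j < k then a j else 0) (fcm_gen k (a k)) = (\<lambda>j. if j < Suc k then a j else 0)"
      by (auto simp: fcm_add_def fcm_gen_def less_Suc_eq)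
    moreover have "(\<lambda>j. if j < k then a j else 0) \<in> FCM m" using a by (auto simp: FCM_def)
    ultimately show ?case
      using add[of "\<lambda>j. if j < k then a j else 0" "fcm_gen k (a k)"] Suc gens[of k "a k"] by simp
  qed
  from this[of m] have "P (\<lambda>j. if j < m then a j else 0)" by simp
  moreover have "(\<lambda>j. if j < m then a j else 0) = a" using a by (auto simp: FCM_def fun_eq_iff)
  ultimately show ?thesis by simp
qed

text \<open>The homomorphism that sends generator \<open>i\<close> to \<open>b i\<close>, as given
  by the universal property of the free commutative monoid.\<close>

definition lin_ext :: "nat \<Rightarrow> (nat \<Rightarrow> fcm) \<Rightarrow> fcm \<Rightarrow> fcm" where
  "lin_ext m b a = (\<lambda>j. \<Sum>i<m. a i * b i j)"

lemma lin_ext_fcm_hom: "(\<And>i. i < m \<Longrightarrow> b i \<in> FCM n) \<Longrightarrow> fcm_hom m n (lin_ext m b)"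
  by (auto simp: fcm_hom_def lin_ext_def FCM_def fcm_add_def fcm_zero_def algebra_simps sum.distrib)

lemma lin_ext_gen: "i < m \<Longrightarrow> lin_ext m b (fcm_gen i 1) = b i"
  by (simp add: lin_ext_def fcm_gen_def fun_eq_iff if_distrib[of "\<lambda>x. x * _"] cong: if_cong)

text \<open>Free objects are projective. Preimages under \<open>g\<close> of the values of \<psi> at
  the generators determine a homomorphism of free monoids, whose extension is \<phi>. The conclusion
  says that \<phi> followed by the projection to \<open>T\<close> is \<psi>; this holds on the dense
  image of the free monoid and extends by continuity.\<close>

lemma cont_hom_lift:
  assumes \<sigma>: "\<sigma> \<in> Cong n" and T: "carrier T = g ` FCM n"
    and g_add: "\<forall>a\<in>FCM n. \<forall>b\<in>FCM n. g (fcm_add a b) = g a \<otimes>\<^bsub>T\<^esub> g b" and g_zero: "g fcm_zero = \<one>\<^bsub>T\<^esub>"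
    and \<psi>: "\<psi> \<in> monoid_hom (OmM m) T" "continuous_map (OmT m) (discrete_topology (carrier T)) \<psi>"
  shows "\<exists>\<phi>\<in>cont_hom m n. \<forall>x\<in>Omega m. \<exists>a\<in>FCM n. a \<in> \<phi> x \<sigma> \<and> \<psi> x = g a"
proof -
  have \<psi>_car: "\<psi> x \<in> carrier T" if "x \<in> Omega m" for x
    using \<psi>(1) that by (simp add: monoid_hom_OmM_iff)
  have "\<forall>i\<in>{..<m}. \<exists>b. b \<in> FCM n \<and> g b = \<psi> (om_of m (fcm_gen i 1))"
    using \<psi>_car[OF om_of_Omega[OF fcm_gen_FCM]] unfolding T by (metis imageE lessThan_iff)
  then have "\<exists>b. \<forall>i\<in>{..<m}. b i \<in> FCM n \<and> g (b i) = \<psi> (om_of m (fcm_gen i 1))" by (rule bchoice)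
  then obtain b where "\<forall>i\<in>{..<m}. b i \<in> FCM n \<and> g (b i) = \<psi> (om_of m (fcm_gen i 1))" ..
  then have b: "b i \<in> FCM n" "g (b i) = \<psi> (om_of m (fcm_gen i 1))" if "i < m" for i
    using that by auto
  define f where "f = lin_ext m b"
  have f: "fcm_hom m n f" unfolding f_def using b(1) by (rule lin_ext_fcm_hom)
  have \<psi>_fin: "\<psi> (om_of m a) = g (f a)" if "a \<in> FCM m" for a
    using that
  proof (induction rule: FCM_induct)
    case zero
    then show ?case using \<psi>(1) f g_zero by (simp add: monoid_hom_OmM_iff fcm_hom_def om_one_eq)
  next
    case (gen i)
    then show ?case using b(2)[OF gen] lin_ext_gen[OF gen, of b] by (simp add: f_def)
  next
    case (add a c)
    have "\<psi> (om_of m (fcm_add a c)) = \<psi> (om_of m a) \<otimes>\<^bsub>T\<^esub> \<psi> (om_of m c)"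
      using \<psi>(1) add(1,2) by (simp add: monoid_hom_OmM_iff om_of_add[symmetric])
    then show ?case using add f g_add by (simp add: fcm_hom_def)
  qed
  have "\<exists>a\<in>FCM n. a \<in> om_map m n f x \<sigma> \<and> \<psi> x = g a" if x: "x \<in> Omega m" for x
  proof -
    \<comment> \<open>As \<open>T\<close> is discrete, \<psi> is constant near \<open>x\<close>, say
      at level \<theta>. An element \<open>a\<close> representing \<open>x\<close> both there and at
      the preimage of \<sigma> transfers the identity from the free monoid to
      \<open>x\<close>.\<close>
    have op: "openin (OmT m) {y \<in> topspace (OmT m). \<psi> y \<in> {\<psi> x}}"
      using \<psi>_car[OF x] by (intro openin_continuous_map_preimage[OF \<psi>(2)]) simp
    have "x \<in> {y \<in> topspace (OmT m). \<psi> y \<in> {\<psi> x}}" using x by simp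
    from OmT_neighbourhood[OF op this] obtain \<theta> where \<theta>: "\<theta> \<in> Cong m"
      "\<forall>y\<in>Omega m. y \<theta> = x \<theta> \<longrightarrow> y \<in> {y \<in> topspace (OmT m). \<psi> y \<in> {\<psi> x}}" .
    obtain a where a: "a \<in> FCM m" "a \<in> x \<theta>" "a \<in> x (pullback_cong m f \<sigma>)"
      using Omega_rep2[OF x \<theta>(1) pullback_cong_Cong[OF f \<sigma>]] .
    have "om_of m a \<theta> = x \<theta>" using Omega_class[OF x \<theta>(1) a(2)] \<theta>(1) by simp
    then have "\<psi> (om_of m a) = \<psi> x" using bspec[OF \<theta>(2) om_of_Omega[OF a(1)]] by simp
    then have "\<psi> x = g (f a)" using \<psi>_fin[OF a(1)] by simp
    moreover have fa: "f a \<in> FCM n" using f a(1) by (simp add: fcm_hom_def)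
    moreover have "f a \<in> om_map m n f x \<sigma>" using om_map_app[OF f \<sigma> x a(3)] Cong_refl[OF \<sigma> fa] by blast
    ultimately show ?thesis by blast
  qed
  then show ?thesis using om_map_cont_hom[OF f] by blast
qed

text \<open>The projection to \<open>T\<close> is the homomorphism at which a pseudoidentity valid
  in \<open>T\<close> gets tested in the end; it separates points whenever \<sigma> does.\<close>

lemma Cong_projection_hom:
  assumes \<sigma>: "\<sigma> \<in> Cong n" and T: "carrier T = g ` FCM n"
    and g_add: "\<forall>a\<in>FCM n. \<forall>b\<in>FCM n. g (fcm_add a b) = g a \<otimes>\<^bsub>T\<^esub> g b" and g_zero: "g fcm_zero = \<one>\<^bsub>T\<^esub>"
    and g_eq: "\<forall>a\<in>FCM n. \<forall>b\<in>FCM n. g a = g b \<longleftrightarrow> (a, b) \<in> \<sigma>"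
  shows "\<exists>\<pi>. \<pi> \<in> monoid_hom (OmM n) T \<and> continuous_map (OmT n) (discrete_topology (carrier T)) \<pi> \<and>
    (\<forall>x\<in>Omega n. \<forall>y\<in>Omega n. \<pi> x = \<pi> y \<longrightarrow> x \<sigma> = y \<sigma>)"
proof -
  define \<pi> :: "om \<Rightarrow> 'a" where "\<pi> x = g (SOME a. a \<in> x \<sigma>)" for x
  have \<pi>: "\<pi> x = g a" if x: "x \<in> Omega n" and a: "a \<in> x \<sigma>" for x a
  proof -
    have s: "(SOME a. a \<in> x \<sigma>) \<in> x \<sigma>" using someI[of "\<lambda>b. b \<in> x \<sigma>" a] a by simp
    then have "((SOME a. a \<in> x \<sigma>), a) \<in> \<sigma>" using Omega_rel[OF x \<sigma> s] a by blast
    then show ?thesis using g_eq Cong_sub[OF \<sigma>] by (auto simp: \<pi>_def)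
  qed
  have car: "\<pi> x \<in> carrier T" if x: "x \<in> Omega n" for x
  proof -
    obtain a where "a \<in> FCM n" "a \<in> x \<sigma>" using Omega_rep[OF x \<sigma>] .
    then show ?thesis using \<pi>[OF x] T by auto
  qed
  have "\<pi> (om_mult n x y) = \<pi> x \<otimes>\<^bsub>T\<^esub> \<pi> y" if x: "x \<in> Omega n" and y: "y \<in> Omega n" for x y
  proof -
    obtain a where a: "a \<in> FCM n" "a \<in> x \<sigma>" using Omega_rep[OF x \<sigma>] .
    obtain b where b: "b \<in> FCM n" "b \<in> y \<sigma>" using Omega_rep[OF y \<sigma>] .
    show ?thesis
      using \<pi>[OF om_mult_Omega[OF x y] om_mult_rep[OF x y \<sigma> a(2) b(2)]] \<pi>[OF x a(2)] \<pi>[OF y b(2)] g_add a b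
      by simp
  qed
  moreover have "\<pi> (om_one n) = \<one>\<^bsub>T\<^esub>"
    using \<pi>[OF om_one_Omega, of fcm_zero] g_zero om_of_rep[OF \<sigma> FCM_zero] by (simp add: om_one_eq)
  ultimately have "\<pi> \<in> monoid_hom (OmM n) T"
    using car by (simp add: monoid_hom_OmM_iff)
  moreover have "continuous_map (OmT n) (discrete_topology (carrier T)) \<pi>"
    unfolding continuous_map_def topspace_OmT
  proof (intro conjI allI impI Pi_I)
    fix U
    show "openin (OmT n) {x \<in> Omega n. \<pi> x \<in> U}"
      unfolding \<pi>_def by (rule openin_OmT_agree[OF \<sigma>])
  qed (use car in auto)
  moreover have "x \<sigma> = y \<sigma>" if x: "x \<in> Omega n" and y: "y \<in> Omega n" and eq: "\<pi> x = \<pi> y" for x y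
  proof -
    obtain a where a: "a \<in> FCM n" "a \<in> x \<sigma>" using Omega_rep[OF x \<sigma>] .
    obtain b where b: "b \<in> FCM n" "b \<in> y \<sigma>" using Omega_rep[OF y \<sigma>] .
    have "g a = g b" using \<pi>[OF x a(2)] \<pi>[OF y b(2)] eq by simp
    then have "(a, b) \<in> \<sigma>" using g_eq a(1) b(1) by blast
    then have "b \<in> x \<sigma>" using Omega_rel[OF x \<sigma> a(2)] by blast
    then show ?thesis using Omega_eq_iff[OF y x \<sigma> b(2)] by simp
  qed
  ultimately show ?thesis by blast
qed

section \<open>The provability relation\<close>

lemma meval_Omega: "(\<forall>i. \<rho> i \<in> Omega n) \<Longrightarrow> meval (OmM n) \<rho> t \<in> Omega n"
  by (induction t) auto

text \<open>A term has finitely many variables. The index 0 is excluded because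
  \<open>Sigma0\<close> reserves it for the substituted side of a pseudoidentity.\<close>

lemma meval_fresh: "\<exists>k>0. \<forall>(M :: ('a, 'c) monoid_scheme) \<rho> x. meval M (\<rho>(k := x)) t = meval M \<rho> t"
proof -
  have "\<exists>N. \<forall>k\<ge>N. \<forall>(M :: ('a, 'c) monoid_scheme) \<rho> x. meval M (\<rho>(k := x)) t = meval M \<rho> t"
  proof (induction t)
    case (MVar i)
    show ?case by (intro exI[of _ "Suc i"]) auto
  next
    case MOne
    show ?case by simp
  next
    case (MMul s t)
    then obtain N N' where
      "\<forall>k\<ge>N. \<forall>(M :: ('a, 'c) monoid_scheme) \<rho> x. meval M (\<rho>(k := x)) s = meval M \<rho> s"
      "\<forall>k\<ge>N'. \<forall>(M :: ('a, 'c) monoid_scheme) \<rho> x. meval M (\<rho>(k := x)) t = meval M \<rho> t"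
      by blast
    then show ?case by (intro exI[of _ "max N N'"]) (simp del: fun_upd_apply)
  qed
  then obtain N where "\<forall>k\<ge>N. \<forall>(M :: ('a, 'c) monoid_scheme) \<rho> x. meval M (\<rho>(k := x)) t = meval M \<rho> t" ..
  then show ?thesis by (intro exI[of _ "Suc N"]) simp
qed

lemma cont_hom_Omega: "\<phi> \<in> cont_hom m n \<Longrightarrow> x \<in> Omega m \<Longrightarrow> \<phi> x \<in> Omega n"
  by (simp add: cont_hom_def monoid_hom_OmM_iff)

lemma Sigma0_refl: "w \<in> Omega n \<Longrightarrow> (w, w) \<in> Sigma0 \<Sigma> n"
  by (auto simp: Sigma0_def)

lemma Sigma0_instance:
  assumes "(m, u, v) \<in> \<Sigma> \<or> (m, v, u) \<in> \<Sigma>" "\<phi> \<in> cont_hom m n" "\<forall>i. \<rho> i \<in> Omega n"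
  shows "(meval (OmM n) (\<rho>(0 := \<phi> u)) t, meval (OmM n) (\<rho>(0 := \<phi> v)) t) \<in> Sigma0 \<Sigma> n"
  using assms unfolding Sigma0_def by blast

lemma Sigma0_cases [consumes 1, case_names refl step]:
  assumes "(x, y) \<in> Sigma0 \<Sigma> n"
  obtains "x \<in> Omega n" "y = x"
  | m u v \<phi> \<rho> t where "(m, u, v) \<in> \<Sigma> \<or> (m, v, u) \<in> \<Sigma>" "\<phi> \<in> cont_hom m n" "\<forall>i. \<rho> i \<in> Omega n"
      "x = meval (OmM n) (\<rho>(0 := \<phi> u)) t" "y = meval (OmM n) (\<rho>(0 := \<phi> v)) t"
  using assms unfolding Sigma0_def by blast

lemma Sigma0_sym: "(x, y) \<in> Sigma0 \<Sigma> n \<Longrightarrow> (y, x) \<in> Sigma0 \<Sigma> n"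
proof (induction rule: Sigma0_cases)
  case refl
  then show ?case by (simp add: Sigma0_refl)
next
  case (step m u v \<phi> \<rho> t)
  have "(m, v, u) \<in> \<Sigma> \<or> (m, u, v) \<in> \<Sigma>" using step(1) by blast
  then show ?case using Sigma0_instance[OF _ step(2,3)] step(4,5) by blast
qed

lemma Sigma0_sub:
  assumes wf: "\<forall>p\<in>\<Sigma>. wf_pid p"
  shows "Sigma0 \<Sigma> n \<subseteq> Omega n \<times> Omega n"
proof (rule subrelI)
  fix x y assume "(x, y) \<in> Sigma0 \<Sigma> n"
  then show "(x, y) \<in> Omega n \<times> Omega n"
  proof (cases rule: Sigma0_cases)
    case refl
    then show ?thesis by simp
  next
    case (step m u v \<phi> \<rho> t)
    have "u \<in> Omega m \<and> v \<in> Omega m" using step(1) wf by (auto simp: wf_pid_def)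
    then have "\<forall>i. (\<rho>(0 := \<phi> u)) i \<in> Omega n" "\<forall>i. (\<rho>(0 := \<phi> v)) i \<in> Omega n"
      using step(2,3) cont_hom_Omega by auto
    then show ?thesis using step(4,5) meval_Omega by blast
  qed
qed

text \<open>The term is extended by one more factor, a variable that does not occur in it and is
  assigned the value \<open>w\<close>.\<close>

lemma Sigma0_mult:
  assumes "(x, y) \<in> Sigma0 \<Sigma> n" and w: "w \<in> Omega n"
  shows "(om_mult n x w, om_mult n y w) \<in> Sigma0 \<Sigma> n"
  using assms(1)
proof (cases rule: Sigma0_cases)
  case refl
  then show ?thesis using w by (simp add: Sigma0_refl)
next
  case (step m u v \<phi> \<rho> t)
  obtain k where k: "k > 0" "\<And>\<rho> x. meval (OmM n) (\<rho>(k := x)) t = meval (OmM n) \<rho> t"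
    using meval_fresh[where 'a = om and 'c = unit, of t] by blast
  have eq: "om_mult n (meval (OmM n) (\<rho>(0 := z)) t) w =
      meval (OmM n) ((\<rho>(k := w))(0 := z)) (MMul t (MVar k))" for z
    using k(1) k(2)[of "\<rho>(0 := z)" w] by (simp add: fun_upd_twist)
  have "\<forall>i. (\<rho>(k := w)) i \<in> Omega n" using step(3) w by simp
  then show ?thesis using Sigma0_instance[OF step(1,2)] unfolding step(4,5) eq by blast
qed

text \<open>The induction principle for provability: minimality replaces transfinite induction over
  the alternating closures.\<close>

lemma provable_rel_least:
  assumes "Sigma0 \<Sigma> n \<subseteq> R" "trans R" "closedin (prod_topology (OmT n) (OmT n)) R"
  shows "provable_rel \<Sigma> n \<subseteq> R"
  using assms unfolding provable_rel_def closure_of_subset_eq[symmetric] by blast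

lemma provable_rel_Sigma0: "Sigma0 \<Sigma> n \<subseteq> provable_rel \<Sigma> n"
  unfolding provable_rel_def by blast

lemma provable_rel_trans: "trans (provable_rel \<Sigma> n)"
  unfolding provable_rel_def trans_def by blast

lemma provable_rel_sub:
  assumes wf: "\<forall>p\<in>\<Sigma>. wf_pid p"
  shows "provable_rel \<Sigma> n \<subseteq> Omega n \<times> Omega n"
proof (rule provable_rel_least[OF Sigma0_sub[OF wf]])
  show "trans (Omega n \<times> Omega n)" by (auto simp: trans_def)
  show "closedin (prod_topology (OmT n) (OmT n)) (Omega n \<times> Omega n)"
    using closedin_topspace[of "prod_topology (OmT n) (OmT n)"] by simp
qed

lemma provable_rel_closed:
  assumes wf: "\<forall>p\<in>\<Sigma>. wf_pid p"
  shows "closedin (prod_topology (OmT n) (OmT n)) (provable_rel \<Sigma> n)"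
proof -
  let ?X = "prod_topology (OmT n) (OmT n)"
  \<comment> \<open>The relations intersected in \<open>provable_rel\<close> need not lie inside the
    space, so they need not be closed sets; the argument runs through monotonicity of the closure
    instead.\<close>
  have "?X closure_of provable_rel \<Sigma> n \<subseteq> R"
    if R: "Sigma0 \<Sigma> n \<subseteq> R" "trans R" "?X closure_of R \<subseteq> R" for R
  proof -
    have "provable_rel \<Sigma> n \<subseteq> R" using R unfolding provable_rel_def by blast
    then have "?X closure_of provable_rel \<Sigma> n \<subseteq> ?X closure_of R" by (rule closure_of_mono)
    then show ?thesis using R(3) by blast
  qed
  then have "?X closure_of provable_rel \<Sigma> n \<subseteq> provable_rel \<Sigma> n"
    unfolding provable_rel_def[of \<Sigma> n] by blast
  then show ?thesis
    using provable_rel_sub[OF wf, of n] closure_of_subset_eq[of "provable_rel \<Sigma> n" ?X] by simp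
qed

text \<open>Symmetry and compatibility are not built into \<open>provable_rel\<close>; both follow
  from minimality. The preimage of the relation under the swap, or under multiplication of both
  components by \<open>w\<close>, is closed by continuity, transitive, and contains
  \<open>Sigma0\<close>.\<close>

lemma provable_rel_congruence:
  assumes wf: "\<forall>p\<in>\<Sigma>. wf_pid p"
  shows "Omega_congruence n (provable_rel \<Sigma> n)"
proof -
  let ?X = "prod_topology (OmT n) (OmT n)" and ?R = "provable_rel \<Sigma> n"
  have R_trans: "(x, z) \<in> ?R" if "(x, y) \<in> ?R" "(y, z) \<in> ?R" for x y z
    using transD[OF provable_rel_trans that] .
  have sub: "?R \<subseteq> Omega n \<times> Omega n" by (rule provable_rel_sub[OF wf])
  have cl: "closedin ?X {p \<in> topspace ?X. h p \<in> ?R}" if "continuous_map ?X ?X h" for h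
    using closedin_continuous_map_preimage[OF that provable_rel_closed[OF wf]] .
  have "?R \<subseteq> {p \<in> topspace ?X. (snd p, fst p) \<in> ?R}"
  proof (rule provable_rel_least)
    show "Sigma0 \<Sigma> n \<subseteq> {p \<in> topspace ?X. (snd p, fst p) \<in> ?R}"
      using Sigma0_sym Sigma0_sub[OF wf] provable_rel_Sigma0 by fastforce
    show "trans {p \<in> topspace ?X. (snd p, fst p) \<in> ?R}"
      unfolding trans_def using R_trans by auto
    show "closedin ?X {p \<in> topspace ?X. (snd p, fst p) \<in> ?R}"
      by (intro cl continuous_map_pairedI continuous_map_fst continuous_map_snd)
  qed
  from subsetD[OF this] have "(y, x) \<in> ?R" if "(x, y) \<in> ?R" for x y
    using that by fastforce
  then have "sym ?R" by (rule symI)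
  moreover have "refl_on (Omega n) ?R"
    unfolding refl_on_def using subsetD[OF provable_rel_Sigma0 Sigma0_refl] by blast
  ultimately have "equiv (Omega n) ?R"
    using sub provable_rel_trans by (simp add: equiv_def)
  moreover have "(om_mult n x w, om_mult n y w) \<in> ?R" if "(x, y) \<in> ?R" and w: "w \<in> Omega n" for x y w
  proof -
    let ?h = "\<lambda>p. (om_mult n (fst p) w, om_mult n (snd p) w)"
    have "?R \<subseteq> {p \<in> topspace ?X. ?h p \<in> ?R}"
    proof (rule provable_rel_least)
      show "Sigma0 \<Sigma> n \<subseteq> {p \<in> topspace ?X. ?h p \<in> ?R}"
        using Sigma0_mult[OF _ w] Sigma0_sub[OF wf] provable_rel_Sigma0 by fastforce
      show "trans {p \<in> topspace ?X. ?h p \<in> ?R}"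
        unfolding trans_def using R_trans by auto
      have "continuous_map ?X (OmT n) (\<lambda>p. om_mult n (fst p) w)"
        using continuous_map_compose[OF continuous_map_fst continuous_map_om_mult[OF w]]
        by (simp add: o_def)
      moreover have "continuous_map ?X (OmT n) (\<lambda>p. om_mult n (snd p) w)"
        using continuous_map_compose[OF continuous_map_snd continuous_map_om_mult[OF w]]
        by (simp add: o_def)
      ultimately show "closedin ?X {p \<in> topspace ?X. ?h p \<in> ?R}"
        by (intro cl continuous_map_pairedI)
    qed
    from subsetD[OF this that(1)] show ?thesis by simp
  qed
  ultimately show ?thesis unfolding Omega_congruence_def by blast
qed

text \<open>A homomorphism \<psi> into \<open>T\<close> lifts to some \<phi> into
  \<open>Omega n\<close>. The \<phi>-images of the two sides of a pseudoidentity in \<Sigma> are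
  related in \<open>Sigma0\<close>, so \<sigma> identifies them and \<psi> takes equal
  values.\<close>

lemma quotient_in_models:
  assumes wf: "\<forall>p\<in>\<Sigma>. wf_pid p"
    and \<sigma>: "\<sigma> \<in> Cong n" "\<And>x y. (x, y) \<in> provable_rel \<Sigma> n \<Longrightarrow> x \<sigma> = y \<sigma>"
    and T: "T \<in> Com" "carrier T = g ` FCM n"
    and g_add: "\<forall>a\<in>FCM n. \<forall>b\<in>FCM n. g (fcm_add a b) = g a \<otimes>\<^bsub>T\<^esub> g b" and g_zero: "g fcm_zero = \<one>\<^bsub>T\<^esub>"
    and g_eq: "\<forall>a\<in>FCM n. \<forall>b\<in>FCM n. g a = g b \<longleftrightarrow> (a, b) \<in> \<sigma>"
  shows "T \<in> models \<Sigma>"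
proof -
  have "\<psi> p = \<psi> q" if \<Sigma>: "(m, p, q) \<in> \<Sigma>" and \<psi>: "\<psi> \<in> monoid_hom (OmM m) T"
    "continuous_map (OmT m) (discrete_topology (carrier T)) \<psi>" for m p q \<psi>
  proof -
    have pq: "p \<in> Omega m" "q \<in> Omega m" using wf \<Sigma> by (auto simp: wf_pid_def)
    obtain \<phi> where \<phi>: "\<phi> \<in> cont_hom m n" "\<forall>x\<in>Omega m. \<exists>a\<in>FCM n. a \<in> \<phi> x \<sigma> \<and> \<psi> x = g a"
      using cont_hom_lift[OF \<sigma>(1) T(2) g_add g_zero \<psi>] by blast
    \<comment> \<open>The term is the single variable 0, which gives the bare substitution instance;
      \<open>om_one n\<close> fills the other variables.\<close>
    have "(\<phi> p, \<phi> q) \<in> Sigma0 \<Sigma> n"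
      using Sigma0_instance[OF _ \<phi>(1), of p q \<Sigma> "\<lambda>_. om_one n" "MVar 0"] \<Sigma> by simp
    then have eq: "\<phi> p \<sigma> = \<phi> q \<sigma>" using \<sigma>(2) provable_rel_Sigma0 by blast
    obtain a where a: "a \<in> FCM n" "a \<in> \<phi> p \<sigma>" "\<psi> p = g a" using bspec[OF \<phi>(2) pq(1)] by blast
    obtain b where b: "b \<in> FCM n" "b \<in> \<phi> q \<sigma>" "\<psi> q = g b" using bspec[OF \<phi>(2) pq(2)] by blast
    have "(a, b) \<in> \<sigma>"
      using Omega_rel[OF cont_hom_Omega[OF \<phi>(1) pq(1)] \<sigma>(1) a(2)] b(2) eq by simp
    then show ?thesis using g_eq a b by simp
  qed
  then have "holds_in T p" if "p \<in> \<Sigma>" for p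
    using that by (cases p) (auto simp: holds_in_def)
  then show ?thesis using T(1) by (simp add: models_def)
qed

theorem theorem10p2:
  shows "strong_Com"
  unfolding strong_Com_def
proof (intro allI impI)
  fix \<Sigma> p
  assume wf: "\<forall>p\<in>\<Sigma>. wf_pid p" and p: "wf_pid p \<and> (\<forall>T\<in>models \<Sigma>. holds_in T p)"
  obtain n u v where p_eq: "p = (n, u, v)" by (cases p)
  have uv: "u \<in> Omega n" "v \<in> Omega n" using p by (auto simp: p_eq wf_pid_def)
  have "(u, v) \<in> provable_rel \<Sigma> n"
  proof (rule ccontr)
    assume "(u, v) \<notin> provable_rel \<Sigma> n"
    from Omega_congruence_Cong_separation[OF provable_rel_congruence[OF wf] provable_rel_closed[OF wf] uv this]
    obtain \<sigma> where \<sigma>: "\<sigma> \<in> Cong n" "\<forall>x y. (x, y) \<in> provable_rel \<Sigma> n \<longrightarrow> x \<sigma> = y \<sigma>" "u \<sigma> \<noteq> v \<sigma>"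
      by (elim bexE conjE)
    obtain T g where T: "T \<in> Com" "carrier T = g ` FCM n"
      "\<forall>a\<in>FCM n. \<forall>b\<in>FCM n. g (fcm_add a b) = g a \<otimes>\<^bsub>T\<^esub> g b" "g fcm_zero = \<one>\<^bsub>T\<^esub>"
      "\<forall>a\<in>FCM n. \<forall>b\<in>FCM n. g a = g b \<longleftrightarrow> (a, b) \<in> \<sigma>"
      using Cong_quotient_monoid[OF \<sigma>(1)] by blast
    have "T \<in> models \<Sigma>"
    proof (rule quotient_in_models[where g = g, OF wf \<sigma>(1)])
      show "x \<sigma> = y \<sigma>" if "(x, y) \<in> provable_rel \<Sigma> n" for x y
        using \<sigma>(2) that by simp
    qed (fact T)+
    then have holds: "holds_in T (n, u, v)" using p p_eq by blast
    obtain \<pi> where \<pi>: "\<pi> \<in> monoid_hom (OmM n) T"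
      "continuous_map (OmT n) (discrete_topology (carrier T)) \<pi>"
      "\<forall>x\<in>Omega n. \<forall>y\<in>Omega n. \<pi> x = \<pi> y \<longrightarrow> x \<sigma> = y \<sigma>"
      using Cong_projection_hom[OF \<sigma>(1) T(2-5)] by blast
    \<comment> \<open>Validity of \<open>u = v\<close> in \<open>T\<close> is applied to the
      projection, whose kernel is equality at level \<sigma>.\<close>
    have "\<pi> u = \<pi> v" using holds \<pi>(1,2) by (simp add: holds_in_def)
    then have "u \<sigma> = v \<sigma>" using \<pi>(3) uv by simp
    then show False using \<sigma>(3) by contradiction
  qed
  then show "provable \<Sigma> p" by (simp add: provable_def p_eq)
qed

end
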